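(* Let $m$ and $n$ be odd integers with $m\equiv 0 \pmod 3$ and $v_3(n)=1$. Then, for each choice of sign, the class number of the quadratic field $\mathbb{Q}\left(\sqrt{-(m^2n^2\pm 4n)/3}\right)$ is divisible by $3$.
   Context: For a prime $p$ and a nonzero integer $n$, $v_p(n)$ denotes the largest exponent $\mu$ such that $p^\mu \mid n$. *)

theory Defs
  imports "HOL-Number_Theory.Cong" "HOL-Computational_Algebra.Polynomial" "HOL-Algebra.Coset" Complex_Main
begin

text \<open>Number fields are represented as subfields of the complex numbers.\<close>

definition quadratic_field :: "rat \<Rightarrow> complex set" where
  "quadratic_field d = {of_rat a + of_rat b * csqrt (of_rat d) | a b. True}"

definition ring_of_integers :: "complex set \<Rightarrow> complex set" where
  "ring_of_integers K = {x \<in> K. algebraic_int x}"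

text \<open>Nonzero fractional ideals: nonzero \<open>\<O>\<close>-submodules of \<open>K\<close> with a common denominator in \<open>\<O>\<close>.\<close>

definition fractional_ideal :: "complex set \<Rightarrow> complex set \<Rightarrow> bool" where
  "fractional_ideal K I \<longleftrightarrow>
     I \<subseteq> K \<and> 0 \<in> I \<and> I \<noteq> {0} \<and>
     (\<forall>x\<in>I. \<forall>y\<in>I. x + y \<in> I) \<and>
     (\<forall>r\<in>ring_of_integers K. \<forall>x\<in>I. r * x \<in> I) \<and>
     (\<exists>c\<in>ring_of_integers K. c \<noteq> 0 \<and> (\<forall>x\<in>I. c * x \<in> ring_of_integers K))"

definition ideal_mult :: "complex set \<Rightarrow> complex set \<Rightarrow> complex set" where
  "ideal_mult I J =
     {(\<Sum>i<k. x i * y i) | (k::nat) x y. (\<forall>i<k. x i \<in> I \<and> y i \<in> J)}"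

definition fractional_ideal_group :: "complex set \<Rightarrow> complex set monoid" where
  "fractional_ideal_group K =
     \<lparr>carrier = {I. fractional_ideal K I}, mult = ideal_mult, one = ring_of_integers K\<rparr>"

definition principal_ideals :: "complex set \<Rightarrow> complex set set" where
  "principal_ideals K = {(\<lambda>x. a * x) ` ring_of_integers K | a. a \<in> K \<and> a \<noteq> 0}"

definition class_group :: "complex set \<Rightarrow> complex set set monoid" where
  "class_group K = fractional_ideal_group K Mod principal_ideals K"

text \<open>The value is \<open>0\<close> should the class group be infinite.\<close>

definition class_number :: "complex set \<Rightarrow> nat" where
  "class_number K = order (class_group K)"

end

theory Submission
  imports Defs "Jordan_Normal_Form.Char_Poly" "HOL-Analysis.Kronecker_Approximation_Theorem"
    "HOL-Algebra.Multiplicative_Group"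
begin

text \<open>Write \<open>m = 3 a\<close>, \<open>n = 3 k\<close>, \<open>e = a\<^sup>2 k\<close>. The field is \<open>K = \<rat>(\<surd>D)\<close> with
  \<open>D = - k (27 e + 4 s) < 0\<close>, and the irreducible cubic \<open>x (x + s)\<^sup>2 = e\<close> has discriminant \<open>a\<^sup>2 D\<close>, so its roots
  \<open>p\<^sub>1, p\<^sub>2, p\<^sub>3\<close> generate a cyclic cubic extension \<open>L\<close> of \<open>K\<close>. It is unramified since
  \<open>(p\<^sub>1 - p\<^sub>2) (p\<^sub>1 - p\<^sub>3) + (p\<^sub>2 - p\<^sub>1) (p\<^sub>2 - p\<^sub>3) + (p\<^sub>3 - p\<^sub>1) (p\<^sub>3 - p\<^sub>2) = 1\<close>.
  Class field theory is replaced by the argument of Hilbert's Theorem 94. If \<open>3\<close> does not divide the class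
  number, then every unit \<open>u\<close> of \<open>L\<close> of relative norm 1 is \<open>v / \<sigma> v\<close> for another such unit \<open>v\<close>.
  As \<open>(1 - \<sigma>)\<^sup>2\<close> is \<open>- 3 \<sigma>\<close> on elements of norm 1, every such unit is then a cube of another one, which
  is impossible for a unit of infinite order because there are only finitely many units with bounded
  conjugates. A unit of infinite order is obtained from Dirichlet's approximation theorem.\<close>

section \<open>Algebraic integers\<close>

text \<open>In exponential notation, 1 + \<sigma> + \<sigma>^2 kills elements of relative norm 1,
  whence (1 - \<sigma>)^2 = -3\<sigma>. The identity behind unramifiedness says that the derivative
  of the cubic takes values with sum 1 at the three roots: this sum is the square of the sum of the
  roots minus 3 times their second symmetric function, here 4 - 3, whatever the constant term. So
  \<open>e\<close> stays free to prescribe the discriminant. The obstacle is to work in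
  \<open>L\<close> without its Galois group or its ring of integers. Elements are triples of
  conjugates rotated cyclically, and an ideal of \<open>L\<close> is replaced by a span over the
  ring of all algebraic integers, from which an ideal of \<open>K\<close> can be recovered because
  it is invertible.\<close>

definition int_span :: "complex set \<Rightarrow> complex set" where
  "int_span S = {(\<Sum>v\<in>S. of_int (c v) * v) | c. True}"

lemma int_span_base: "finite S \<Longrightarrow> v \<in> S \<Longrightarrow> v \<in> int_span S"
  unfolding int_span_def mem_Collect_eq
proof (rule exI[of _ "\<lambda>x. if x = v then 1 else 0"], intro conjI TrueI)
  assume "finite S" "v \<in> S"
  have "(\<Sum>u\<in>S. of_int (if u = v then 1 else 0) * u) = (\<Sum>u\<in>S. if u = v then u else 0)"
    by (intro sum.cong) auto
  thus "v = (\<Sum>u\<in>S. of_int (if u = v then 1 else 0) * u)"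
    using \<open>finite S\<close> \<open>v \<in> S\<close> by simp
qed

lemma int_span_0: "0 \<in> int_span S"
  unfolding int_span_def mem_Collect_eq by (rule exI[of _ "\<lambda>_. 0"]) simp

lemma int_span_add:
  assumes "x \<in> int_span S" "y \<in> int_span S" shows "x + y \<in> int_span S"
proof -
  obtain c d where "x = (\<Sum>v\<in>S. of_int (c v) * v)" "y = (\<Sum>v\<in>S. of_int (d v) * v)"
    using assms unfolding int_span_def by blast
  hence "x + y = (\<Sum>v\<in>S. of_int (c v + d v) * v)" by (simp add: sum.distrib distrib_right)
  thus ?thesis unfolding int_span_def mem_Collect_eq by (intro exI[of _ "\<lambda>v. c v + d v"]) simp
qed

lemma int_span_scale:
  assumes "x \<in> int_span S" shows "of_int n * x \<in> int_span S"
proof -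
  obtain c where "x = (\<Sum>v\<in>S. of_int (c v) * v)" using assms unfolding int_span_def by blast
  hence "of_int n * x = (\<Sum>v\<in>S. of_int (n * c v) * v)" by (simp add: sum_distrib_left mult.assoc)
  thus ?thesis unfolding int_span_def mem_Collect_eq by (intro exI[of _ "\<lambda>v. n * c v"]) simp
qed

lemma int_span_sum: "(\<And>i. i \<in> I \<Longrightarrow> f i \<in> int_span S) \<Longrightarrow> (\<Sum>i\<in>I. f i) \<in> int_span S"
  by (induction I rule: infinite_finite_induct) (auto intro: int_span_add int_span_0)

text \<open>Determinant trick: multiplication by \<open>x\<close> acts on the spanning elements by
  an integer matrix, so \<open>x\<close> is a root of its monic characteristic polynomial.\<close>

lemma algebraic_int_if_span_stable:
  assumes fin: "finite S" and s: "s \<in> S" "s \<noteq> 0"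
    and stable: "\<And>v. v \<in> S \<Longrightarrow> x * v \<in> int_span S"
  shows "algebraic_int x"
proof -
  obtain vs where vs: "set vs = S" "distinct vs"
    using fin finite_distinct_list by blast
  define n where "n = length vs"
  have "\<exists>c::nat \<Rightarrow> int. x * vs ! i = (\<Sum>j<n. of_int (c j) * vs ! j)" if "i < n" for i
  proof -
    have "x * vs ! i \<in> int_span S" using stable that vs n_def by auto
    then obtain u where u: "x * vs ! i = (\<Sum>v\<in>S. of_int (u v) * v)"
      unfolding int_span_def by blast
    have "bij_betw (\<lambda>j. vs ! j) {..<n} S"
      using vs n_def by (simp add: bij_betw_nth)
    from sum.reindex_bij_betw[OF this, of "\<lambda>v. of_int (u v) * v"] u
    have "x * vs ! i = (\<Sum>j<n. of_int (u (vs ! j)) * vs ! j)" by simp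
    thus ?thesis by (intro exI[of _ "\<lambda>j. u (vs ! j)"])
  qed
  then obtain c :: "nat \<Rightarrow> nat \<Rightarrow> int"
    where c: "\<And>i. i < n \<Longrightarrow> x * vs ! i = (\<Sum>j<n. of_int (c i j) * vs ! j)" by metis
  define A :: "int mat" where "A = Matrix.mat n n (\<lambda>(i, j). c i j)"
  define A' :: "complex mat" where "A' = map_mat of_int A"
  have A: "A \<in> carrier_mat n n" and A': "A' \<in> carrier_mat n n" by (auto simp: A_def A'_def)
  define v :: "complex Matrix.vec" where "v = Matrix.vec n (\<lambda>i. vs ! i)"
  have "A' *\<^sub>v v = x \<cdot>\<^sub>v v"
    by (rule eq_vecI) (auto simp: A'_def A_def v_def scalar_prod_def c atLeast0LessThan)
  moreover have "v \<noteq> 0\<^sub>v n"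
  proof
    assume v0: "v = 0\<^sub>v n"
    obtain i where i: "i < n" "vs ! i = s" using s vs n_def by (metis in_set_conv_nth)
    have "v $ i = 0" using v0 i by simp
    thus False using i s by (simp add: v_def)
  qed
  ultimately have "eigenvalue A' x"
    using A' unfolding eigenvalue_def eigenvector_def by (intro exI[of _ v]) (auto simp: v_def)
  hence "poly (char_poly A') x = 0" using eigenvalue_root_char_poly[OF A'] by simp
  moreover have "char_poly A' = map_poly of_int (char_poly A)"
    unfolding A'_def by (rule of_int_hom.char_poly_hom[OF A])
  moreover have "lead_coeff (char_poly A) = 1" using degree_monic_char_poly[OF A] by metis
  ultimately show ?thesis unfolding algebraic_int_altdef_ipoly by auto
qed

lemma algebraic_int_power_reduction:
  assumes "algebraic_int (x::complex)"
  obtains n c where "n > 0" "x ^ n = (\<Sum>l<n. of_int (c l) * x ^ l)"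
proof -
  obtain p where p: "poly (map_poly of_int p) x = 0" "lead_coeff p = 1"
    using assms algebraic_int_altdef_ipoly by auto
  define n where "n = degree p"
  have eq: "(\<Sum>l\<le>n. of_int (Polynomial.coeff p l) * x ^ l) = 0"
    using p(1) by (simp add: poly_altdef n_def)
  have "x ^ n = (\<Sum>l<n. of_int (- Polynomial.coeff p l) * x ^ l)"
    using eq p(2) by (simp add: lessThan_Suc_atMost[symmetric] n_def sum_negf add_eq_0_iff)
  \<comment> \<open>For \<open>n = 0\<close> the empty sum would give 1 = 0.\<close>
  moreover have "n > 0"
    using calculation by (cases "n = 0") auto
  ultimately show ?thesis using that[of n "\<lambda>l. - Polynomial.coeff p l"] by simp
qed

text \<open>The monomials with exponents below the degrees of monic equations for \<open>x\<close>
  and \<open>y\<close> span a module stable under multiplication by \<open>x\<close> and by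
  \<open>y\<close>.\<close>

lemma algebraic_int_plus_times:
  assumes "algebraic_int (x::complex)" "algebraic_int y"
  shows "algebraic_int (x + y) \<and> algebraic_int (x * y)"
proof -
  obtain n c where n: "n > 0" "x ^ n = (\<Sum>l<n. of_int (c l) * x ^ l)"
    using algebraic_int_power_reduction[OF assms(1)] .
  obtain m d where m: "m > 0" "y ^ m = (\<Sum>l<m. of_int (d l) * y ^ l)"
    using algebraic_int_power_reduction[OF assms(2)] .
  define S where "S = {x ^ i * y ^ j |i j. i < n \<and> j < m}"
  let ?M = "int_span S"
  have "S = (\<lambda>(i, j). x ^ i * y ^ j) ` ({..<n} \<times> {..<m})" by (auto simp: S_def)
  hence fin: "finite S" by simp
  have one: "1 \<in> S" unfolding S_def using n m by (auto intro!: exI[of _ 0])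
  have mem: "x ^ i * y ^ j \<in> ?M" if "i < n" "j < m" for i j
    using that by (intro int_span_base fin) (auto simp: S_def)
  have xS: "x * v \<in> ?M" if v: "v \<in> S" for v
  proof -
    obtain i j where ij: "i < n" "j < m" "v = x ^ i * y ^ j" using v unfolding S_def by blast
    show ?thesis
    proof (cases "Suc i < n")
      case True
      thus ?thesis using mem[of "Suc i" j] ij by (simp add: mult_ac)
    next
      case False
      hence "Suc i = n" using ij by simp
      hence "x * v = x ^ n * y ^ j" using ij by auto
      also have "\<dots> = (\<Sum>l<n. of_int (c l) * (x ^ l * y ^ j))"
        by (simp add: n(2) sum_distrib_left mult_ac)
      also have "\<dots> \<in> ?M"
        by (intro int_span_sum int_span_scale mem) (use ij in auto)
      finally show ?thesis .
    qed
  qed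
  have yS: "y * v \<in> ?M" if v: "v \<in> S" for v
  proof -
    obtain i j where ij: "i < n" "j < m" "v = x ^ i * y ^ j" using v unfolding S_def by blast
    show ?thesis
    proof (cases "Suc j < m")
      case True
      thus ?thesis using mem[of i "Suc j"] ij by (simp add: mult_ac)
    next
      case False
      hence "Suc j = m" using ij by simp
      hence "y * v = x ^ i * y ^ m" using ij by auto
      also have "\<dots> = (\<Sum>l<m. of_int (d l) * (x ^ i * y ^ l))"
        by (simp add: m(2) sum_distrib_left mult_ac)
      also have "\<dots> \<in> ?M"
        by (intro int_span_sum int_span_scale mem) (use ij in auto)
      finally show ?thesis .
    qed
  qed
  have xM: "x * v \<in> ?M" if v: "v \<in> ?M" for v
  proof -
    obtain a where "v = (\<Sum>u\<in>S. of_int (a u) * u)" using v unfolding int_span_def by blast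
    hence "x * v = (\<Sum>u\<in>S. of_int (a u) * (x * u))" by (simp add: sum_distrib_left mult_ac)
    thus ?thesis by (simp add: int_span_sum int_span_scale xS)
  qed
  have "algebraic_int (x + y)"
    using fin one
    by (rule algebraic_int_if_span_stable)
       (auto simp: distrib_right intro!: int_span_add xS yS)
  moreover have "algebraic_int (x * y)"
    using fin one
    by (rule algebraic_int_if_span_stable) (auto simp: mult.assoc intro!: xM yS)
  ultimately show ?thesis by blast
qed

lemma algebraic_int_plus: "algebraic_int x \<Longrightarrow> algebraic_int y \<Longrightarrow> algebraic_int (x + y :: complex)"
  and algebraic_int_times: "algebraic_int x \<Longrightarrow> algebraic_int y \<Longrightarrow> algebraic_int (x * y :: complex)"
  using algebraic_int_plus_times by auto

lemma algebraic_int_diff: "algebraic_int x \<Longrightarrow> algebraic_int y \<Longrightarrow> algebraic_int (x - y :: complex)"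
  using algebraic_int_plus[of x "- y"] by auto

lemma algebraic_int_power: "algebraic_int x \<Longrightarrow> algebraic_int (x ^ n :: complex)"
  by (induction n) (auto intro: algebraic_int_times)

lemmas algebraic_int_closed =
  algebraic_int_plus algebraic_int_times algebraic_int_diff algebraic_int_power algebraic_int_minus
  algebraic_int_0 algebraic_int_1 algebraic_int_numeral algebraic_int_of_int

lemma algebraic_int_monic_quadratic:
  assumes "(x::complex)\<^sup>2 = of_int b * x + of_int c"
  shows "algebraic_int x"
proof (rule algebraic_int.intros)
  show "poly [: - of_int c, - of_int b, 1 :] x = 0"
    using assms by (simp add: power2_eq_square algebra_simps)
  show "\<forall>i. Polynomial.coeff [: - of_int c, - of_int b, 1 :: complex:] i \<in> \<int>"
    by (auto simp: coeff_pCons split: nat.splits)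
qed simp

lemma algebraic_int_monic_cubic:
  assumes "(x::complex) ^ 3 = of_int b * x\<^sup>2 + of_int c * x + of_int d"
  shows "algebraic_int x"
proof (rule algebraic_int.intros)
  show "poly [: - of_int d, - of_int c, - of_int b, 1 :] x = 0"
    using assms by (simp add: power2_eq_square power3_eq_cube algebra_simps)
  show "\<forall>i. Polynomial.coeff [: - of_int d, - of_int c, - of_int b, 1 :: complex:] i \<in> \<int>"
    by (auto simp: coeff_pCons split: nat.splits)
qed simp

section \<open>Imaginary quadratic fields\<close>

lemma cnj_of_rat [simp]: "cnj (of_rat a) = of_rat a"
  by (induct a) (simp add: of_rat_rat)

lemma complex_of_rat_eq: "complex_of_rat a = complex_of_real (of_rat a)"
  by (induct a) (simp add: of_rat_rat)

locale imaginary_quadratic =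
  fixes D :: int
  assumes D_neg: "D < 0"
begin

definition w :: complex where "w = csqrt (of_int D)"
definition K :: "complex set" where "K = quadratic_field (of_int D)"
abbreviation OK :: "complex set" where "OK \<equiv> ring_of_integers K"

lemma w_squared: "w * w = of_int D"
  unfolding w_def using power2_csqrt[of "of_int D"] by (simp add: power2_eq_square)

lemma w_eq: "w = \<i> * sqrt (- of_int D)"
  unfolding w_def using D_neg csqrt_of_real_nonpos[of "of_int D"] by simp

lemma cnj_w: "cnj w = - w"
  by (simp add: w_eq)

lemma K_iff: "x \<in> K \<longleftrightarrow> (\<exists>a b. x = of_rat a + of_rat b * w)"
  by (simp add: K_def quadratic_field_def w_def)

lemma K_of_rat: "of_rat a \<in> K"
  unfolding K_iff by (rule exI[of _ a], rule exI[of _ 0]) simp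

lemma K_of_int: "of_int n \<in> K"
  using K_of_rat[of "of_int n"] by simp

lemma K_0: "0 \<in> K" and K_1: "1 \<in> K" and K_numeral: "numeral k \<in> K"
  using K_of_int[of 0] K_of_int[of 1] K_of_int[of "numeral k"] by simp_all

lemma K_w: "w \<in> K"
  unfolding K_iff by (rule exI[of _ 0], rule exI[of _ 1]) simp

lemma K_add: assumes "x \<in> K" "y \<in> K" shows "x + y \<in> K"
proof -
  obtain a b c d where "x = of_rat a + of_rat b * w" "y = of_rat c + of_rat d * w"
    using assms K_iff by metis
  hence "x + y = of_rat (a + c) + of_rat (b + d) * w"
    by (simp add: of_rat_add algebra_simps)
  thus ?thesis unfolding K_iff by blast
qed

lemma K_minus: assumes "x \<in> K" shows "- x \<in> K"
proof -
  obtain a b where "x = of_rat a + of_rat b * w" using assms K_iff by metis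
  hence "- x = of_rat (- a) + of_rat (- b) * w" by (simp add: of_rat_minus)
  thus ?thesis unfolding K_iff by blast
qed

lemma K_diff: "x \<in> K \<Longrightarrow> y \<in> K \<Longrightarrow> x - y \<in> K"
  using K_add[of x "- y"] K_minus[of y] by simp

lemma K_mult: assumes "x \<in> K" "y \<in> K" shows "x * y \<in> K"
proof -
  obtain a b c d where *: "x = of_rat a + of_rat b * w" "y = of_rat c + of_rat d * w"
    using assms K_iff by metis
  have "x * y = of_rat a * of_rat c + of_rat b * of_rat d * (w * w) + (of_rat a * of_rat d + of_rat b * of_rat c) * w"
    by (simp add: * algebra_simps)
  also have "\<dots> = of_rat (a * c + b * d * of_int D) + of_rat (a * d + b * c) * w"
    by (simp add: w_squared of_rat_add of_rat_mult)
  finally show ?thesis unfolding K_iff by blast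
qed

lemma K_power: "x \<in> K \<Longrightarrow> x ^ n \<in> K"
  by (induction n) (auto intro: K_mult K_1)

lemma K_cnj: assumes "x \<in> K" shows "cnj x \<in> K"
proof -
  obtain a b where "x = of_rat a + of_rat b * w" using assms K_iff by metis
  hence "cnj x = of_rat a + of_rat (- b) * w" by (simp add: of_rat_minus cnj_w)
  thus ?thesis unfolding K_iff by blast
qed

lemma K_trace_norm:
  assumes "x \<in> K" shows "x + cnj x \<in> \<rat>" "x * cnj x \<in> \<rat>"
proof -
  obtain a b where x: "x = of_rat a + of_rat b * w" using assms K_iff by metis
  have "x + cnj x = of_rat (2 * a)" by (simp add: x cnj_w of_rat_mult)
  thus "x + cnj x \<in> \<rat>" by simp
  have "x * cnj x = of_rat a * of_rat a - of_rat b * of_rat b * (w * w)"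
    by (simp add: x cnj_w algebra_simps)
  also have "\<dots> = of_rat (a * a - b * b * of_int D)"
    by (simp add: w_squared of_rat_mult of_rat_diff)
  finally show "x * cnj x \<in> \<rat>" by simp
qed

lemma K_Rats: "x \<in> \<rat> \<Longrightarrow> x \<in> K"
  using K_of_rat by (auto elim: Rats_cases)

lemma K_inverse: assumes "x \<in> K" shows "inverse x \<in> K"
proof (cases "x = 0")
  case False
  have "inverse x = cnj x * inverse (x * cnj x)" using False by simp
  also have "\<dots> \<in> K"
    by (intro K_mult K_cnj K_Rats Rats_inverse K_trace_norm assms)
  finally show ?thesis .
qed (simp add: K_0)

lemma K_divide: "x \<in> K \<Longrightarrow> y \<in> K \<Longrightarrow> x / y \<in> K"
  by (simp add: divide_inverse K_inverse K_mult)

lemmas K_closed = K_add K_mult K_diff K_minus K_power K_divide K_0 K_1 K_numeral K_of_int K_w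

lemma OK_iff: "x \<in> OK \<longleftrightarrow> x \<in> K \<and> algebraic_int x"
  by (simp add: ring_of_integers_def)

lemma OK_of_int: "of_int n \<in> OK" and OK_0: "0 \<in> OK" and OK_1: "1 \<in> OK"
  by (auto simp: OK_iff K_closed)

lemma OK_w: "w \<in> OK"
  using w_squared by (auto simp: OK_iff K_w power2_eq_square intro!: algebraic_int_monic_quadratic[of _ 0 D])

lemma OK_add: "x \<in> OK \<Longrightarrow> y \<in> OK \<Longrightarrow> x + y \<in> OK"
  and OK_mult: "x \<in> OK \<Longrightarrow> y \<in> OK \<Longrightarrow> x * y \<in> OK"
  and OK_diff: "x \<in> OK \<Longrightarrow> y \<in> OK \<Longrightarrow> x - y \<in> OK"
  and OK_cnj: "x \<in> OK \<Longrightarrow> cnj x \<in> OK"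
  by (auto simp: OK_iff K_closed K_cnj algebraic_int_plus algebraic_int_times algebraic_int_diff)

lemma OK_subset_K: "x \<in> OK \<Longrightarrow> x \<in> K" by (simp add: OK_iff)

lemma OK_Rats_Ints: "x \<in> OK \<Longrightarrow> x \<in> \<rat> \<Longrightarrow> x \<in> \<int>"
  using rational_algebraic_int_is_int OK_iff by blast

lemma OK_trace_norm:
  assumes "x \<in> OK" shows "x + cnj x \<in> \<int>" "x * cnj x \<in> \<int>"
  using assms K_trace_norm[of x] OK_Rats_Ints[of "x + cnj x"] OK_Rats_Ints[of "x * cnj x"]
  by (auto simp: OK_add OK_mult OK_cnj OK_subset_K)

lemma K_denominator:
  assumes "x \<in> K"
  obtains n :: int where "n > 0" "of_int n * x \<in> OK"
proof -
  obtain a b where x: "x = of_rat a + of_rat b * w" using assms K_iff by metis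
  obtain p q where pq: "quotient_of a = (p, q)" by force
  obtain r t where rt: "quotient_of b = (r, t)" by force
  have q: "q > 0" "t > 0" using quotient_of_denom_pos pq rt by auto
  have a: "a = of_int p / of_int q" "b = of_int r / of_int t"
    using quotient_of_div pq rt by auto
  have *: "of_int q * of_rat a = (of_int p :: complex)" "of_int t * of_rat b = (of_int r :: complex)"
    using q unfolding a of_rat_divide of_rat_of_int_eq by auto
  have "of_int (q * t) * x = of_int t * (of_int q * of_rat a) + of_int q * (of_int t * of_rat b) * w"
    unfolding x of_int_mult by (simp only: distrib_left mult_ac)
  also have "\<dots> = of_int (p * t) + of_int (r * q) * w" unfolding * by simp
  also have "\<dots> \<in> OK" by (intro OK_add OK_mult OK_of_int OK_w)
  finally show ?thesis using that[of "q * t"] q by auto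
qed

lemma finite_bounded_Ints: "finite {n :: int. \<bar>real_of_int n\<bar> \<le> B}"
  by (rule finite_subset[of _ "{- \<lceil>B\<rceil>..\<lceil>B\<rceil>}"]) (auto simp: abs_le_iff, linarith+)

text \<open>Complex conjugation is the nontrivial automorphism of \<open>K\<close>, so a bound on
  the absolute value bounds the integers trace and norm and leaves finitely many quadratic
  polynomials.\<close>

lemma finite_OK_bounded: "finite {x \<in> OK. cmod x \<le> B}"
proof -
  define P where "P = (\<lambda>(t::int, n::int). [: of_int n, - of_int t, 1 :: complex :])"
  let ?I = "{n :: int. \<bar>real_of_int n\<bar> \<le> max (2 * B) (B * B)}"
  have "{x \<in> OK. cmod x \<le> B} \<subseteq> (\<Union>p \<in> ?I \<times> ?I. {x. poly (P p) x = 0})"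
  proof safe
    fix x assume x: "x \<in> OK" "cmod x \<le> B"
    obtain t n where tn: "x + cnj x = of_int t" "x * cnj x = of_int n"
      using OK_trace_norm[OF x(1)] by (auto elim!: Ints_cases)
    have "cmod (of_int t) \<le> 2 * B"
      using x norm_triangle_ineq[of x "cnj x"] unfolding tn(1)[symmetric] by simp
    moreover have "cmod (of_int n) \<le> B * B"
      using x unfolding tn(2)[symmetric] by (simp add: norm_mult mult_mono')
    ultimately have "(t, n) \<in> ?I \<times> ?I" by auto
    moreover have "poly (P (t, n)) x = 0"
      by (simp add: P_def tn[symmetric] algebra_simps)
    ultimately show "x \<in> (\<Union>p \<in> ?I \<times> ?I. {x. poly (P p) x = 0})" by blast
  qed
  moreover have "finite (\<Union>p \<in> ?I \<times> ?I. {x. poly (P p) x = 0})"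
    by (intro finite_UN_I finite_cartesian_product finite_bounded_Ints poly_roots_finite)
       (auto simp: P_def)
  ultimately show ?thesis using finite_subset by blast
qed

text \<open>Only \<open>\<rat>(\<surd>-3)\<close> has units of order 3; it is excluded by \<open>3\<close> being unramified.\<close>

lemma sqrt_minus_3_notin_K:
  assumes "\<not> 3 dvd D" "x \<in> K" shows "x\<^sup>2 \<noteq> -3"
proof
  assume x2: "x\<^sup>2 = -3"
  obtain a b where x: "x = of_rat a + of_rat b * w" using assms K_iff by metis
  have "cnj (x\<^sup>2) = x\<^sup>2" by (simp add: x2)
  hence "(x - cnj x) * (x + cnj x) = 0" by (simp add: power2_eq_square algebra_simps)
  moreover have "x \<noteq> cnj x"
  proof
    assume "x = cnj x"
    hence "x \<in> \<real>" by (simp add: Reals_cnj_iff)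
    then obtain r where "x = of_real r" by (auto elim: Reals_cases)
    hence "complex_of_real (r\<^sup>2) = of_real (-3)" using x2 by simp
    hence "r\<^sup>2 = -3" using of_real_eq_iff by blast
    thus False using zero_le_power2[of r] by linarith
  qed
  ultimately have "x + cnj x = 0" by simp
  hence "a = 0" by (simp add: x cnj_w flip: of_rat_mult)
  hence "x\<^sup>2 = of_rat (b\<^sup>2 * of_int D)"
    by (simp add: x power2_eq_square of_rat_mult w_squared[symmetric])
  hence "of_rat (b\<^sup>2 * of_int D) = (of_rat (-3) :: complex)" by (simp add: x2)
  hence bD: "b\<^sup>2 * of_int D = -3" using of_rat_eq_iff by blast
  obtain p q where pq: "quotient_of b = (p, q)" by force
  have q: "q > 0" "coprime p q" using quotient_of_denom_pos quotient_of_coprime pq by auto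
  have "b = of_int p / of_int q" using quotient_of_div pq by auto
  hence bq: "of_int p = b * of_int q" using q by simp
  have "of_int (p\<^sup>2 * D) = (b\<^sup>2 * of_int D) * of_int (q\<^sup>2)"
    by (simp add: bq power_mult_distrib)
  hence "of_int (p\<^sup>2 * D) = (of_int (-3 * q\<^sup>2) :: rat)" by (simp add: bD)
  \<comment> \<open>As 3 does not divide \<open>D\<close>, this forces 3 to divide \<open>p\<close>
    and then \<open>q\<close>.\<close>
  hence eq: "p\<^sup>2 * D = -3 * q\<^sup>2" using of_int_eq_iff by blast
  hence dvd: "3 dvd p\<^sup>2 * D" by simp
  have prime_numeral_3: "prime (3::int)" by simp
  hence p: "3 dvd p" using assms(1) dvd by (metis prime_dvd_multD prime_dvd_power prime_numeral_3)
  then obtain p' where "p = 3 * p'" by auto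
  hence "3 * (p'\<^sup>2 * D) = - q\<^sup>2" using eq by (simp add: power2_eq_square mult_ac)
  hence "3 dvd q\<^sup>2" by (metis dvd_triv_left dvd_minus_iff)
  hence "3 dvd q" using prime_dvd_power prime_numeral_3 by blast
  thus False using coprime_common_divisor[OF q(2) p] by simp
qed

text \<open>A unit has absolute value 1, so its trace is at most 2 in absolute value; trace 1 or -1
  would put a square root of -3 into \<open>K\<close>. The exponent 4 is what the norm correction at
  the end of \<open>hilbert94\<close> requires.\<close>

lemma OK_unit_power4:
  assumes D3: "\<not> 3 dvd D" and e: "e \<in> OK" "e' \<in> OK" "e * e' = 1"
  shows "e ^ 4 = 1"
proof -
  obtain t where t: "e + cnj e = of_int t"
    using OK_trace_norm[OF e(1)] by (auto elim!: Ints_cases)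
  obtain n where n: "e * cnj e = of_int n"
    using OK_trace_norm[OF e(1)] by (auto elim!: Ints_cases)
  obtain n' where n': "e' * cnj e' = of_int n'"
    using OK_trace_norm[OF e(2)] by (auto elim!: Ints_cases)
  have "of_int (n * n') = (e * e') * cnj (e * e')" by (simp add: n[symmetric] n'[symmetric])
  hence "of_int (n * n') = (of_int 1 :: complex)" by (simp add: e(3))
  hence nn: "n * n' = 1" using of_int_eq_iff by blast
  have "complex_of_real (of_int n) = of_real ((cmod e)\<^sup>2)"
    using n by (simp add: complex_norm_square del: of_real_power)
  hence nc: "of_int n = (cmod e)\<^sup>2" using of_real_eq_iff by blast
  hence "n \<ge> 0" by (metis of_int_0_le_iff zero_le_power2)
  hence n1: "n = 1" using nn by (simp add: zmult_eq_1_iff)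
  hence "cmod e = 1" using nc by (simp add: power2_eq_1_iff) (smt (verit) norm_ge_zero)
  hence "cmod (of_int t) \<le> 2" using norm_triangle_ineq[of e "cnj e"] t by simp
  hence t2: "\<bar>t\<bar> \<le> 2" by simp
  have q: "e\<^sup>2 - of_int t * e + 1 = 0"
    using n by (simp add: t[symmetric] n1 power2_eq_square algebra_simps)
  consider "t = 0" | "t = 1" | "t = -1" | "t = 2" | "t = -2" using t2 by linarith
  thus ?thesis
  proof cases
    case 1
    hence "e\<^sup>2 = -1" using q by (simp add: add_eq_0_iff2)
    thus ?thesis by (simp add: power4_eq_xxxx power2_eq_square)
  next
    case 2
    hence "e * e = e - 1" using q by (simp add: power2_eq_square algebra_simps)
    moreover have "(2 * e - 1)\<^sup>2 = 4 * (e * e) - 4 * e + 1" by (simp add: power2_eq_square algebra_simps)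
    ultimately have "(2 * e - 1)\<^sup>2 = -3" by simp
    moreover have "2 * e - 1 \<in> K" using OK_subset_K[OF e(1)] by (intro K_closed)
    ultimately show ?thesis using sqrt_minus_3_notin_K[OF D3] by blast
  next
    case 3
    hence "e * e + e + 1 = 0" using q by (simp add: power2_eq_square)
    hence "e * e = - e - 1" by (metis add.assoc add_diff_cancel_right' diff_0 diff_diff_eq uminus_add_conv_diff)
    moreover have "(2 * e + 1)\<^sup>2 = 4 * (e * e) + 4 * e + 1" by (simp add: power2_eq_square algebra_simps)
    ultimately have "(2 * e + 1)\<^sup>2 = -3" by simp
    moreover have "2 * e + 1 \<in> K" using OK_subset_K[OF e(1)] by (intro K_closed)
    ultimately show ?thesis using sqrt_minus_3_notin_K[OF D3] by blast
  next
    case 4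
    hence "(e - 1)\<^sup>2 = 0" using q by (simp add: power2_eq_square algebra_simps)
    thus ?thesis by simp
  next
    case 5
    hence "(e + 1)\<^sup>2 = 0" using q by (simp add: power2_eq_square algebra_simps)
    hence "e = -1" by (simp add: add_eq_0_iff2)
    thus ?thesis by simp
  qed
qed

end

section \<open>Products of ideals\<close>

lemma ideal_mult_prod: "x \<in> I \<Longrightarrow> y \<in> J \<Longrightarrow> x * y \<in> ideal_mult I J"
  unfolding ideal_mult_def mem_Collect_eq
  by (intro exI[of _ "1::nat"] exI[of _ "\<lambda>_. x"] exI[of _ "\<lambda>_. y"]) auto

lemma ideal_mult_0: "0 \<in> ideal_mult I J"
  unfolding ideal_mult_def by (auto intro!: exI[of _ "0::nat"])

lemma ideal_mult_add:
  assumes "a \<in> ideal_mult I J" "b \<in> ideal_mult I J"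
  shows "a + b \<in> ideal_mult I J"
proof -
  obtain k x y where a: "a = (\<Sum>i<(k::nat). x i * y i)" "\<forall>i<k. x i \<in> I \<and> y i \<in> J"
    using assms(1) unfolding ideal_mult_def by blast
  obtain l u v where b: "b = (\<Sum>i<(l::nat). u i * v i)" "\<forall>i<l. u i \<in> I \<and> v i \<in> J"
    using assms(2) unfolding ideal_mult_def by blast
  let ?f = "\<lambda>i. if i < k then x i else u (i - k)" and ?g = "\<lambda>i. if i < k then y i else v (i - k)"
  have "(\<Sum>i<k + l. ?f i * ?g i) = (\<Sum>i<k. ?f i * ?g i) + (\<Sum>i<l. ?f (k + i) * ?g (k + i))"
    by (induction l) (auto simp: add.assoc)
  hence "a + b = (\<Sum>i<k + l. ?f i * ?g i)" by (simp add: a b)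
  moreover have "\<forall>i<k + l. ?f i \<in> I \<and> ?g i \<in> J" using a(2) b(2) by auto
  ultimately show ?thesis
    unfolding ideal_mult_def mem_Collect_eq by (intro exI[of _ "k + l"] exI[of _ ?f] exI[of _ ?g]) simp
qed

text \<open>Acts as the induction rule for products of ideals; \<open>S\<close> is often chosen as a
  preimage, such as the \<open>z\<close> with \<open>z * c\<close> in a given product.\<close>

lemma ideal_mult_least:
  assumes "0 \<in> S" "\<And>a b. a \<in> S \<Longrightarrow> b \<in> S \<Longrightarrow> a + b \<in> S"
    and "\<And>x y. x \<in> I \<Longrightarrow> y \<in> J \<Longrightarrow> x * y \<in> S"
  shows "ideal_mult I J \<subseteq> S"
proof
  fix z assume "z \<in> ideal_mult I J"
  then obtain k x y where z: "z = (\<Sum>i<(k::nat). x i * y i)" "\<forall>i<k. x i \<in> I \<and> y i \<in> J"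
    unfolding ideal_mult_def by blast
  have "(\<Sum>i<l. x i * y i) \<in> S" if "l \<le> k" for l
    using that by (induction l) (use z(2) assms in auto)
  thus "z \<in> S" using z(1) by auto
qed

lemma ideal_mult_mono: "I \<subseteq> I' \<Longrightarrow> J \<subseteq> J' \<Longrightarrow> ideal_mult I J \<subseteq> ideal_mult I' J'"
  by (rule ideal_mult_least) (auto intro: ideal_mult_0 ideal_mult_add ideal_mult_prod)

lemma ideal_mult_commute: "ideal_mult I J = ideal_mult J I"
proof -
  have "ideal_mult I J \<subseteq> ideal_mult J I" for I J
  proof (rule ideal_mult_least)
    fix x y assume "x \<in> I" "y \<in> J"
    thus "x * y \<in> ideal_mult J I" by (subst mult.commute) (rule ideal_mult_prod)
  qed (auto intro: ideal_mult_0 ideal_mult_add)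
  thus ?thesis by blast
qed

lemma ideal_mult_assoc: "ideal_mult (ideal_mult I J) L = ideal_mult I (ideal_mult J L)"
proof -
  have *: "ideal_mult (ideal_mult I J) L \<subseteq> ideal_mult I (ideal_mult J L)" for I J L
  proof (rule ideal_mult_least)
    fix z c assume z: "z \<in> ideal_mult I J" and c: "c \<in> L"
    have "ideal_mult I J \<subseteq> {z. z * c \<in> ideal_mult I (ideal_mult J L)}"
    proof (rule ideal_mult_least)
      fix x y assume "x \<in> I" "y \<in> J"
      hence "x * (y * c) \<in> ideal_mult I (ideal_mult J L)" using c by (intro ideal_mult_prod)
      thus "x * y \<in> {z. z * c \<in> ideal_mult I (ideal_mult J L)}" by (simp add: mult.assoc)
    qed (auto simp: distrib_right intro: ideal_mult_0 ideal_mult_add)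
    thus "z * c \<in> ideal_mult I (ideal_mult J L)" using z by auto
  qed (auto intro: ideal_mult_0 ideal_mult_add)
  show ?thesis
    \<comment> \<open>The reverse inclusion is the same one with \<open>I\<close> and
      \<open>L\<close> exchanged, by commutativity.\<close>
    using *[of I J L] *[of L J I]
    by (simp add: ideal_mult_commute[of L] ideal_mult_commute[of "ideal_mult _ _" I]
        ideal_mult_commute[of J I] ideal_mult_commute[of L J] subset_antisym)
qed

definition ideal_scale :: "complex \<Rightarrow> complex set \<Rightarrow> complex set" where
  "ideal_scale a I = (\<lambda>x. a * x) ` I"

lemma ideal_scale_scale: "ideal_scale a (ideal_scale b I) = ideal_scale (a * b) I"
  by (auto simp: ideal_scale_def image_image mult.assoc)

lemma ideal_scale_1 [simp]: "ideal_scale 1 I = I"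
  by (simp add: ideal_scale_def)

lemma ideal_mult_scale: "ideal_mult (ideal_scale a I) J = ideal_scale a (ideal_mult I J)"
proof
  show "ideal_mult (ideal_scale a I) J \<subseteq> ideal_scale a (ideal_mult I J)"
  proof (rule ideal_mult_least)
    show "0 \<in> ideal_scale a (ideal_mult I J)"
      unfolding ideal_scale_def using ideal_mult_0 by (auto intro!: image_eqI[of _ _ 0])
    fix x y assume "x \<in> ideal_scale a (ideal_mult I J)" "y \<in> ideal_scale a (ideal_mult I J)"
    then obtain x' y' where "x = a * x'" "y = a * y'" "x' \<in> ideal_mult I J" "y' \<in> ideal_mult I J"
      by (auto simp: ideal_scale_def)
    thus "x + y \<in> ideal_scale a (ideal_mult I J)"
      unfolding ideal_scale_def by (auto simp: ideal_mult_add distrib_left intro!: image_eqI[of _ _ "x' + y'"])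
  qed (auto simp: ideal_scale_def mult.assoc intro: ideal_mult_prod)
  have "ideal_mult I J \<subseteq> {z. a * z \<in> ideal_mult (ideal_scale a I) J}"
  proof (rule ideal_mult_least)
    fix x y assume "x \<in> I" "y \<in> J"
    hence "a * x * y \<in> ideal_mult (ideal_scale a I) J"
      by (intro ideal_mult_prod) (auto simp: ideal_scale_def)
    thus "x * y \<in> {z. a * z \<in> ideal_mult (ideal_scale a I) J}" by (simp add: mult.assoc)
  qed (auto simp: distrib_left intro: ideal_mult_0 ideal_mult_add)
  thus "ideal_scale a (ideal_mult I J) \<subseteq> ideal_mult (ideal_scale a I) J"
    unfolding ideal_scale_def[of a "ideal_mult I J"] by blast
qed

section \<open>The class group\<close>

context imaginary_quadratic
begin

section \<open>Fractional ideals and their inverses\<close>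

lemma fractional_idealI:
  assumes "I \<subseteq> K" "0 \<in> I" "x \<in> I" "x \<noteq> 0"
    and "\<And>x y. x \<in> I \<Longrightarrow> y \<in> I \<Longrightarrow> x + y \<in> I"
    and "\<And>r x. r \<in> OK \<Longrightarrow> x \<in> I \<Longrightarrow> r * x \<in> I"
    and "c \<in> OK" "c \<noteq> 0" "\<And>x. x \<in> I \<Longrightarrow> c * x \<in> OK"
  shows "fractional_ideal K I"
  unfolding fractional_ideal_def
  by (intro conjI ballI bexI[of _ c]) (use assms in \<open>simp_all, blast\<close>)

lemma fractional_idealD:
  assumes "fractional_ideal K I"
  shows "x \<in> I \<Longrightarrow> x \<in> K" "0 \<in> I" "x \<in> I \<Longrightarrow> y \<in> I \<Longrightarrow> x + y \<in> I"
    "r \<in> OK \<Longrightarrow> x \<in> I \<Longrightarrow> r * x \<in> I"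
  using assms unfolding fractional_ideal_def by (simp_all add: subset_iff)

lemma fractional_ideal_diff:
  assumes "fractional_ideal K I" "x \<in> I" "y \<in> I" shows "x - y \<in> I"
  using fractional_idealD(3)[OF assms(1) assms(2), of "- y"]
    fractional_idealD(4)[OF assms(1) OK_of_int[of "-1"] assms(3)] by simp

lemma fractional_ideal_nonzero:
  assumes "fractional_ideal K I" obtains x where "x \<in> I" "x \<noteq> 0"
  using assms unfolding fractional_ideal_def by blast

lemma fractional_ideal_denominator:
  assumes "fractional_ideal K I"
  obtains c where "c \<in> OK" "c \<noteq> 0" "\<And>x. x \<in> I \<Longrightarrow> c * x \<in> OK"
  using assms unfolding fractional_ideal_def by blast

lemma fractional_ideal_OK: "fractional_ideal K OK"
  by (rule fractional_idealI[of _ 1 1]) (auto intro: OK_add OK_mult OK_0 OK_1 OK_subset_K)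

lemma fractional_ideal_scale:
  assumes I: "fractional_ideal K I" and a: "a \<in> K" "a \<noteq> 0"
  shows "fractional_ideal K (ideal_scale a I)"
proof -
  obtain x where x: "x \<in> I" "x \<noteq> 0" using fractional_ideal_nonzero[OF I] .
  obtain c where c: "c \<in> OK" "c \<noteq> 0" "\<And>x. x \<in> I \<Longrightarrow> c * x \<in> OK"
    using fractional_ideal_denominator[OF I] by blast
  obtain n :: int where n: "n > 0" "of_int n * a \<in> OK" using K_denominator[OF a(1)] .
  note D = fractional_idealD[OF I]
  show ?thesis
  proof (rule fractional_idealI[of _ "a * x" "of_int n * c"])
    fix r y assume "r \<in> OK" "y \<in> ideal_scale a I"
    thus "r * y \<in> ideal_scale a I" using D(4) by (auto simp: ideal_scale_def mult.left_commute)
  next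
    fix y z assume "y \<in> ideal_scale a I" "z \<in> ideal_scale a I"
    thus "y + z \<in> ideal_scale a I" using D(3) by (auto simp: ideal_scale_def distrib_left[symmetric])
  next
    fix y assume "y \<in> ideal_scale a I"
    then obtain y' where y: "y' \<in> I" "y = a * y'" by (auto simp: ideal_scale_def)
    have "of_int n * c * y = (of_int n * a) * (c * y')" by (simp add: y)
    thus "of_int n * c * y \<in> OK" using n(2) c(3)[OF y(1)] OK_mult by metis
  next
    show "0 \<in> ideal_scale a I" using D(2) unfolding ideal_scale_def by (auto intro!: image_eqI[of _ _ 0])
  qed (use x a c n D in \<open>auto simp: ideal_scale_def intro: K_mult OK_mult OK_of_int\<close>)
qed

lemma fractional_ideal_mult:
  assumes I: "fractional_ideal K I" and J: "fractional_ideal K J"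
  shows "fractional_ideal K (ideal_mult I J)"
proof -
  obtain x where x: "x \<in> I" "x \<noteq> 0" using fractional_ideal_nonzero[OF I] .
  obtain y where y: "y \<in> J" "y \<noteq> 0" using fractional_ideal_nonzero[OF J] .
  obtain c where c: "c \<in> OK" "c \<noteq> 0" "\<And>x. x \<in> I \<Longrightarrow> c * x \<in> OK"
    using fractional_ideal_denominator[OF I] by blast
  obtain d where d: "d \<in> OK" "d \<noteq> 0" "\<And>x. x \<in> J \<Longrightarrow> d * x \<in> OK"
    using fractional_ideal_denominator[OF J] by blast
  note DI = fractional_idealD[OF I] and DJ = fractional_idealD[OF J]
  show ?thesis
  proof (rule fractional_idealI[of _ "x * y" "c * d"])
    show "ideal_mult I J \<subseteq> K"
      using DI DJ by (intro ideal_mult_least) (auto intro: K_closed)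
    fix r z assume r: "r \<in> OK" and z: "z \<in> ideal_mult I J"
    have "ideal_mult I J \<subseteq> {z. r * z \<in> ideal_mult I J}"
    proof (rule ideal_mult_least)
      fix x y assume "x \<in> I" "y \<in> J"
      hence "r * x * y \<in> ideal_mult I J" by (intro ideal_mult_prod DI(4) r)
      thus "x * y \<in> {z. r * z \<in> ideal_mult I J}" by (simp add: mult.assoc)
    qed (auto simp: distrib_left intro: ideal_mult_0 ideal_mult_add)
    thus "r * z \<in> ideal_mult I J" using z by auto
  next
    fix z assume z: "z \<in> ideal_mult I J"
    have "ideal_mult I J \<subseteq> {z. c * d * z \<in> OK}"
    proof (rule ideal_mult_least)
      fix u v assume "u \<in> I" "v \<in> J"
      hence "(c * u) * (d * v) \<in> OK" by (intro OK_mult c d)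
      thus "u * v \<in> {z. c * d * z \<in> OK}" by (simp add: mult_ac)
    qed (auto simp: distrib_left intro: OK_add OK_0)
    thus "c * d * z \<in> OK" using z by auto
  qed (use x y c d in \<open>auto intro: ideal_mult_0 ideal_mult_add ideal_mult_prod OK_mult\<close>)
qed

lemma ideal_mult_OK:
  assumes "fractional_ideal K I" shows "ideal_mult OK I = I"
proof
  show "ideal_mult OK I \<subseteq> I"
    using fractional_idealD[OF assms] by (intro ideal_mult_least) auto
  show "I \<subseteq> ideal_mult OK I"
    using ideal_mult_prod[OF OK_1] by fastforce
qed

text \<open>If \<open>d\<close> generates the integers in \<open>I I'\<close>, where \<open>I'\<close> is the conjugate of \<open>I\<close>,
  then for \<open>x, y \<in> I\<close> the trace and the norm of \<open>x y' / d\<close> are integral, so \<open>I I' \<subseteq> (d)\<close>.\<close>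

lemma integral_ideal_times_conjugate:
  assumes I: "fractional_ideal K I" and int: "I \<subseteq> OK"
  obtains d :: int where "d > 0" "ideal_mult I (cnj ` I) = ideal_scale (of_int d) OK"
proof -
  let ?P = "ideal_mult I (cnj ` I)"
  obtain x0 where x0: "x0 \<in> I" "x0 \<noteq> 0" using fractional_ideal_nonzero[OF I] .
  note DI = fractional_idealD[OF I]
  define G where "G = {n :: int. of_int n \<in> ?P}"
  have P_OK: "r * z \<in> ?P" if "r \<in> OK" "z \<in> ?P" for r z
  proof -
    have "?P \<subseteq> {z. r * z \<in> ?P}"
    proof (rule ideal_mult_least)
      fix x y assume "x \<in> I" "y \<in> cnj ` I"
      hence "r * x * y \<in> ?P" by (intro ideal_mult_prod DI(4) that)
      thus "x * y \<in> {z. r * z \<in> ?P}" by (simp add: mult.assoc)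
    qed (auto simp: distrib_left intro: ideal_mult_0 ideal_mult_add)
    thus ?thesis using that(2) by auto
  qed
  have G_mult: "a * n \<in> G" if "n \<in> G" for a n
    using that P_OK[OF OK_of_int[of a]] by (simp add: G_def)
  have G_add: "a + b \<in> G" if "a \<in> G" "b \<in> G" for a b
    using that ideal_mult_add by (simp add: G_def)
  have norm_G: "\<exists>n \<in> G. x * cnj x = of_int n" if x: "x \<in> I" for x
  proof -
    obtain n where "x * cnj x = of_int n"
      using OK_trace_norm[of x] int x by (auto elim!: Ints_cases)
    thus ?thesis using ideal_mult_prod[of x I "cnj x" "cnj ` I"] x by (auto simp: G_def)
  qed
  have trace_G: "\<exists>n \<in> G. x * cnj y + y * cnj x = of_int n" if xy: "x \<in> I" "y \<in> I" for x y
  proof -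
    have "x * cnj y \<in> OK" using xy int by (auto intro: OK_mult OK_cnj)
    from OK_trace_norm(1)[OF this] obtain n where n: "x * cnj y + y * cnj x = of_int n"
      by (auto elim!: Ints_cases simp: mult.commute)
    have "x * cnj y + y * cnj x \<in> ?P"
      using xy by (intro ideal_mult_add ideal_mult_prod) auto
    thus ?thesis using n by (auto simp: G_def)
  qed
  obtain n0 where n0: "n0 \<in> G" "x0 * cnj x0 = of_int n0" using norm_G x0 by blast
  have "complex_of_real (of_int n0) = of_real ((cmod x0)\<^sup>2)"
    using n0 by (simp add: complex_norm_square del: of_real_power)
  hence "of_int n0 = (cmod x0)\<^sup>2" using of_real_eq_iff by blast
  hence "real_of_int n0 > 0" using x0 by simp
  hence n0_pos: "n0 > 0" by simp
  define m where "m = (LEAST m::nat. m > 0 \<and> int m \<in> G)"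
  have m: "m > 0 \<and> int m \<in> G"
    unfolding m_def by (rule LeastI[of _ "nat n0"]) (use n0_pos n0 in auto)
  define d where "d = int m"
  have d: "d > 0" "d \<in> G" using m d_def by auto
  have dvd: "d dvd n" if "n \<in> G" for n
  proof -
    have "n mod d = n + (- (n div d)) * d" using minus_div_mult_eq_mod[of n d] by simp
    hence "n mod d \<in> G" using G_add[OF that G_mult[OF d(2)]] by metis
    hence "\<not> (0 < nat (n mod d) \<and> nat (n mod d) < m)"
      using not_less_Least[of "nat (n mod d)" "\<lambda>m. m > 0 \<and> int m \<in> G"] d
      by (auto simp: m_def)
    moreover have "nat (n mod d) < m" using d pos_mod_bound[of d n] d_def by (simp add: nat_less_iff)
    ultimately have "n mod d \<le> 0" by simp
    hence "n mod d = 0" using pos_mod_sign[OF d(1), of n] by linarith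
    thus ?thesis by (simp add: dvd_eq_mod_eq_0)
  qed
  have sub: "?P \<subseteq> ideal_scale (of_int d) OK"
  proof (rule ideal_mult_least)
    show "0 \<in> ideal_scale (of_int d) OK" using OK_0 unfolding ideal_scale_def by (auto intro!: image_eqI[of _ _ 0])
    show "a + b \<in> ideal_scale (of_int d) OK" if "a \<in> ideal_scale (of_int d) OK" "b \<in> ideal_scale (of_int d) OK" for a b
      using that unfolding ideal_scale_def by (auto simp: distrib_left[symmetric] intro!: imageI OK_add)
    fix x z assume "x \<in> I" "z \<in> cnj ` I"
    then obtain y where xy: "x \<in> I" "y \<in> I" and z: "z = cnj y" by auto
    obtain t where t: "x * cnj y + y * cnj x = of_int (d * t)"
      using trace_G[OF xy] dvd unfolding dvd_def by metis
    obtain u where u: "x * cnj x = of_int (d * u)"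
      using norm_G[OF xy(1)] dvd unfolding dvd_def by metis
    obtain v where v: "y * cnj y = of_int (d * v)"
      using norm_G[OF xy(2)] dvd unfolding dvd_def by metis
    \<comment> \<open>Trace and norm of \<open>q\<close> are \<open>t\<close> and
      \<open>u * v\<close>, since \<open>d\<close> divides the trace of \<open>x * cnj y\<close> and
      the norms of both factors; so \<open>q\<close> is a root of X^2 - t X + u v.\<close>
    define q where "q = x * cnj y / of_int d"
    have dq: "of_int d * q = x * cnj y" using d by (simp add: q_def)
    have "(of_int d)\<^sup>2 * q\<^sup>2 = (x * cnj y)\<^sup>2" by (simp add: dq[symmetric] power_mult_distrib)
    also have "\<dots> = (x * cnj y + y * cnj x) * (x * cnj y) - (x * cnj x) * (y * cnj y)"
      by (simp add: power2_eq_square algebra_simps)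
    also have "\<dots> = of_int (d * t) * (of_int d * q) - of_int (d * u) * of_int (d * v)"
      by (simp only: t u v dq)
    also have "\<dots> = (of_int d)\<^sup>2 * (of_int t * q + of_int (- (u * v)))"
      by (simp add: power2_eq_square algebra_simps)
    finally have "q\<^sup>2 = of_int t * q + of_int (- (u * v))" using d by simp
    hence "algebraic_int q" by (rule algebraic_int_monic_quadratic)
    moreover have "q \<in> K"
      unfolding q_def using xy DI(1) by (intro K_closed K_cnj) auto
    ultimately have "q \<in> OK" by (simp add: OK_iff)
    thus "x * z \<in> ideal_scale (of_int d) OK"
      unfolding ideal_scale_def z dq[symmetric] by (rule imageI)
  qed
  moreover have "ideal_scale (of_int d) OK \<subseteq> ?P"
    using P_OK d(2) by (auto simp: ideal_scale_def G_def mult.commute)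
  ultimately show ?thesis using that[of d] d by blast
qed

lemma fractional_ideal_cnj:
  assumes I: "fractional_ideal K I" shows "fractional_ideal K (cnj ` I)"
proof -
  obtain x where x: "x \<in> I" "x \<noteq> 0" using fractional_ideal_nonzero[OF I] .
  obtain c where c: "c \<in> OK" "c \<noteq> 0" "\<And>x. x \<in> I \<Longrightarrow> c * x \<in> OK"
    using fractional_ideal_denominator[OF I] by blast
  note D = fractional_idealD[OF I]
  show ?thesis
  proof (rule fractional_idealI[of _ "cnj x" "cnj c"])
    fix r y assume r: "r \<in> OK" and "y \<in> cnj ` I"
    then obtain z where z: "z \<in> I" "y = cnj z" by auto
    have "r * y = cnj (cnj r * z)" using z by simp
    thus "r * y \<in> cnj ` I" using D(4)[OF OK_cnj[OF r] z(1)] by blast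
  next
    fix y z assume "y \<in> cnj ` I" "z \<in> cnj ` I"
    thus "y + z \<in> cnj ` I" using D(3) by (auto simp: complex_cnj_add[symmetric] simp del: complex_cnj_add)
  next
    fix y assume "y \<in> cnj ` I"
    then obtain z where z: "z \<in> I" "y = cnj z" by auto
    thus "cnj c * y \<in> OK" using OK_cnj[OF c(3)[OF z(1)]] by simp
  next
    show "0 \<in> cnj ` I" using D(2) by (auto intro!: image_eqI[of _ _ 0])
  qed (use x c D in \<open>auto intro: K_cnj OK_cnj\<close>)
qed

text \<open>Once \<open>c\<close> clears denominators, the product of the ideal with its conjugate
  is generated by an integer \<open>d\<close>, so the conjugate divided by \<open>d\<close> is an
  inverse. No factorization into primes is involved.\<close>

lemma fractional_ideal_inverse:
  assumes I: "fractional_ideal K I"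
  obtains J where "fractional_ideal K J" "ideal_mult J I = OK"
proof -
  obtain c where c: "c \<in> OK" "c \<noteq> 0" "\<And>x. x \<in> I \<Longrightarrow> c * x \<in> OK"
    using fractional_ideal_denominator[OF I] by blast
  have cI: "fractional_ideal K (ideal_scale c I)"
    using fractional_ideal_scale I c OK_subset_K by blast
  moreover have "ideal_scale c I \<subseteq> OK" using c by (auto simp: ideal_scale_def)
  ultimately obtain d :: int where d: "d > 0"
    "ideal_mult (ideal_scale c I) (cnj ` ideal_scale c I) = ideal_scale (of_int d) OK"
    by (rule integral_ideal_times_conjugate)
  define J where "J = ideal_scale (c / of_int d) (cnj ` ideal_scale c I)"
  have "ideal_mult J I = ideal_scale (1 / of_int d) (ideal_mult (ideal_scale c I) (cnj ` ideal_scale c I))"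
    by (simp add: J_def ideal_mult_scale ideal_scale_scale ideal_mult_commute[of "cnj ` _"])
  hence "ideal_mult J I = OK" using d by (simp add: ideal_scale_scale)
  moreover have "fractional_ideal K J"
    unfolding J_def using c d
    by (intro fractional_ideal_scale fractional_ideal_cnj cI K_divide K_of_int OK_subset_K) auto
  ultimately show ?thesis using that by blast
qed

text \<open>Extending an ideal to all algebraic integers and intersecting with \<open>K\<close>
  gives the ideal back: for the inverse \<open>J\<close> of \<open>I\<close>, the products of
  \<open>x\<close> with \<open>J\<close> are integral and in \<open>K\<close>, so \<open>x\<close>
  lies in \<open>x J I\<close>, a part of \<open>I\<close>. This stands in for the contraction of
  ideals from \<open>L\<close> to \<open>K\<close>.\<close>

lemma mem_ideal_if_mem_algebraic_int_span:
  assumes I: "fractional_ideal K I" and x: "x \<in> K" "x \<in> ideal_mult (Collect algebraic_int) I"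
  shows "x \<in> I"
proof -
  obtain J where J: "fractional_ideal K J" "ideal_mult J I = OK"
    using fractional_ideal_inverse[OF I] by blast
  have xJ: "x * y \<in> OK" if "y \<in> J" for y
  proof -
    have "x * y \<in> ideal_mult (ideal_mult (Collect algebraic_int) I) J"
      using x(2) that by (rule ideal_mult_prod)
    also have "\<dots> = ideal_mult (Collect algebraic_int) OK"
      by (simp add: ideal_mult_assoc ideal_mult_commute[of I] J)
    also have "\<dots> \<subseteq> Collect algebraic_int"
      by (intro ideal_mult_least) (auto simp: OK_iff algebraic_int_closed)
    finally show ?thesis using x(1) that fractional_idealD(1)[OF J(1)] by (simp add: OK_iff K_mult)
  qed
  have "ideal_mult J I \<subseteq> {z. x * z \<in> I}"
  proof (rule ideal_mult_least)
    fix y z assume "y \<in> J" "z \<in> I"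
    hence "x * y * z \<in> I" by (intro fractional_idealD(4)[OF I] xJ)
    thus "y * z \<in> {z. x * z \<in> I}" by (simp add: mult.assoc)
  qed (auto simp: distrib_left intro: fractional_idealD[OF I])
  thus ?thesis using J OK_1 by auto
qed

section \<open>The class group and ideals with principal cube\<close>

abbreviation IG :: "complex set monoid" where "IG \<equiv> fractional_ideal_group K"

lemma IG_simps [simp]:
  "carrier IG = {I. fractional_ideal K I}" "monoid.mult IG = ideal_mult" "one IG = OK"
  by (simp_all add: fractional_ideal_group_def)

lemma comm_group_IG: "comm_group IG"
proof (rule comm_groupI)
  fix I assume "I \<in> carrier IG"
  thus "\<exists>J\<in>carrier IG. J \<otimes>\<^bsub>IG\<^esub> I = \<one>\<^bsub>IG\<^esub>"
    using fractional_ideal_inverse[of I] by auto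
next
  fix I J assume "I \<in> carrier IG" "J \<in> carrier IG"
  show "I \<otimes>\<^bsub>IG\<^esub> J = J \<otimes>\<^bsub>IG\<^esub> I" using ideal_mult_commute by simp
qed (simp_all add: fractional_ideal_mult fractional_ideal_OK ideal_mult_OK ideal_mult_assoc)

lemma principal_ideals_eq: "principal_ideals K = {ideal_scale a OK | a. a \<in> K \<and> a \<noteq> 0}"
  by (simp add: principal_ideals_def ideal_scale_def)

lemma principal_fractional: "a \<in> K \<Longrightarrow> a \<noteq> 0 \<Longrightarrow> fractional_ideal K (ideal_scale a OK)"
  by (intro fractional_ideal_scale fractional_ideal_OK)

lemma principal_mult: "fractional_ideal K I \<Longrightarrow> ideal_mult (ideal_scale a OK) I = ideal_scale a I"
  by (simp add: ideal_mult_scale ideal_mult_OK)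

lemma subgroup_principal: "subgroup (principal_ideals K) IG"
proof -
  interpret comm_group IG by (rule comm_group_IG)
  show ?thesis
  proof (rule subgroupI)
    show "principal_ideals K \<subseteq> carrier IG"
      by (auto simp: principal_ideals_eq principal_fractional)
    show "principal_ideals K \<noteq> {}"
      using K_1 by (auto simp: principal_ideals_eq intro!: exI[of _ 1])
    fix I assume "I \<in> principal_ideals K"
    then obtain a where a: "a \<in> K" "a \<noteq> 0" "I = ideal_scale a OK" by (auto simp: principal_ideals_eq)
    have "ideal_scale (1 / a) OK \<otimes>\<^bsub>IG\<^esub> I = \<one>\<^bsub>IG\<^esub>"
      using a by (simp add: principal_mult principal_fractional ideal_scale_scale)
    moreover have "fractional_ideal K (ideal_scale (1 / a) OK)" "fractional_ideal K I"
      using a by (auto intro!: principal_fractional K_closed)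
    ultimately have "inv\<^bsub>IG\<^esub> I = ideal_scale (1 / a) OK" by (intro inv_equality) auto
    thus "inv\<^bsub>IG\<^esub> I \<in> principal_ideals K"
      using a K_divide[OF K_1 a(1)] by (auto simp: principal_ideals_eq)
    fix J assume "J \<in> principal_ideals K"
    then obtain b where b: "b \<in> K" "b \<noteq> 0" "J = ideal_scale b OK" by (auto simp: principal_ideals_eq)
    have "I \<otimes>\<^bsub>IG\<^esub> J = ideal_scale (a * b) OK"
      using a b by (simp add: principal_mult principal_fractional ideal_scale_scale)
    thus "I \<otimes>\<^bsub>IG\<^esub> J \<in> principal_ideals K"
      using a b K_mult[of a b] by (auto simp: principal_ideals_eq)
  qed
qed

lemma normal_principal: "principal_ideals K \<lhd> IG"
  using comm_group.normal_iff_subgroup[OF comm_group_IG] subgroup_principal by blast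

lemma group_class_group: "group (class_group K)"
  unfolding class_group_def by (rule normal.factorgroup_is_group[OF normal_principal])

lemma coset_scale:
  assumes I: "fractional_ideal K I" and a: "a \<in> K" "a \<noteq> 0"
  shows "principal_ideals K #>\<^bsub>IG\<^esub> ideal_scale a I = principal_ideals K #>\<^bsub>IG\<^esub> I"
proof -
  interpret comm_group IG by (rule comm_group_IG)
  have "ideal_scale a I = ideal_scale a OK \<otimes>\<^bsub>IG\<^esub> I" using I by (simp add: principal_mult)
  moreover have "ideal_scale a OK \<in> principal_ideals K" using a by (auto simp: principal_ideals_eq)
  ultimately have "ideal_scale a I \<in> principal_ideals K #>\<^bsub>IG\<^esub> I"
    unfolding r_coset_def by blast
  thus ?thesis using repr_independence[OF _ _ subgroup_principal, of "ideal_scale a I" I] I by auto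
qed

text \<open>The class of \<open>I\<close> is killed by 3 and by the class number, which are coprime.
  An infinite class group would have \<open>class_number\<close> 0, which \<open>n3\<close>
  excludes.\<close>

lemma principal_if_cube_principal:
  assumes n3: "\<not> 3 dvd class_number K"
    and I: "fractional_ideal K I" and g: "g \<in> K" "g \<noteq> 0"
    and cube: "ideal_mult I (ideal_mult I I) = ideal_scale g OK"
  obtains a where "a \<in> K" "a \<noteq> 0" "I = ideal_scale a OK"
proof -
  interpret G: comm_group IG by (rule comm_group_IG)
  interpret N: normal "principal_ideals K" IG by (rule normal_principal)
  interpret C: group "class_group K" by (rule group_class_group)
  let ?P = "principal_ideals K"
  define X where "X = ?P #>\<^bsub>IG\<^esub> I"
  have II: "fractional_ideal K (ideal_mult I I)" using I fractional_ideal_mult by blast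
  have mult: "monoid.mult (class_group K) = set_mult IG" and one: "\<one>\<^bsub>class_group K\<^esub> = ?P"
    by (auto simp: class_group_def)
  have X: "X \<in> carrier (class_group K)"
    using I by (auto simp: class_group_def carrier_FactGroup X_def)
  have "X \<otimes>\<^bsub>class_group K\<^esub> (X \<otimes>\<^bsub>class_group K\<^esub> X) = ?P #>\<^bsub>IG\<^esub> ideal_scale g OK"
    using N.rcos_sum[of I I] N.rcos_sum[of I "ideal_mult I I"] I II by (simp add: X_def cube mult)
  also have "\<dots> = ?P #>\<^bsub>IG\<^esub> OK"
    by (rule coset_scale[OF fractional_ideal_OK g])
  also have "\<dots> = ?P"
    using G.coset_mult_one N.subset by simp
  finally have "X \<otimes>\<^bsub>class_group K\<^esub> (X \<otimes>\<^bsub>class_group K\<^esub> X) = ?P" .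
  moreover have "X [^]\<^bsub>class_group K\<^esub> (3::nat) = X \<otimes>\<^bsub>class_group K\<^esub> (X \<otimes>\<^bsub>class_group K\<^esub> X)"
    using X by (simp add: numeral_3_eq_3 C.m_assoc)
  ultimately have X3: "X [^]\<^bsub>class_group K\<^esub> (3::nat) = \<one>\<^bsub>class_group K\<^esub>"
    by (simp only: one)
  let ?h = "class_number K"
  have Xh: "X [^]\<^bsub>class_group K\<^esub> ?h = \<one>\<^bsub>class_group K\<^esub>"
    unfolding class_number_def using X by (rule C.pow_order_eq_1)
  have "X [^]\<^bsub>class_group K\<^esub> (3 * (?h div 3) + ?h mod 3)
    = (X [^]\<^bsub>class_group K\<^esub> (3::nat)) [^]\<^bsub>class_group K\<^esub> (?h div 3) \<otimes>\<^bsub>class_group K\<^esub> X [^]\<^bsub>class_group K\<^esub> (?h mod 3)"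
    using X by (simp add: C.nat_pow_mult C.nat_pow_pow)
  hence Xr: "X [^]\<^bsub>class_group K\<^esub> (?h mod 3) = \<one>\<^bsub>class_group K\<^esub>"
    using X X3 Xh by simp
  have "?h mod 3 = 1 \<or> ?h mod 3 = 2" using n3 by (simp add: dvd_eq_mod_eq_0) linarith
  hence "X = \<one>\<^bsub>class_group K\<^esub>"
  proof
    assume "?h mod 3 = 1" thus ?thesis using Xr X by simp
  next
    assume "?h mod 3 = 2"
    hence X2: "X [^]\<^bsub>class_group K\<^esub> (2::nat) = \<one>\<^bsub>class_group K\<^esub>" using Xr by simp
    have "X [^]\<^bsub>class_group K\<^esub> (3::nat) = X [^]\<^bsub>class_group K\<^esub> (2::nat) \<otimes>\<^bsub>class_group K\<^esub> X"
      by (simp add: numeral_3_eq_3 numeral_2_eq_2)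
    thus ?thesis using X2 X3 X by simp
  qed
  hence "?P #>\<^bsub>IG\<^esub> I = ?P" by (simp add: X_def one)
  hence "I \<in> ?P" using G.coset_join1[OF _ _ subgroup_principal] I by auto
  thus ?thesis using that by (auto simp: principal_ideals_eq)
qed

text \<open>Finiteness: every ideal class contains an ideal in which 1 is a nonzero element of least absolute value;
  by Dirichlet's theorem such an ideal lies between \<open>OK\<close> and \<open>1/M OK\<close> for a uniform \<open>M\<close>.\<close>

lemma K_approximation:
  obtains Q :: int where "Q > 0"
    "\<And>y. y \<in> K \<Longrightarrow> \<exists>q::int. \<exists>z\<in>OK. 0 < q \<and> q \<le> Q \<and> cmod (of_int q * y - z) < 1"
proof -
  \<comment> \<open>Two coordinates are approximated within 1/N, which leaves an error below (1 +
    |w|)/N; this choice makes it at most 1, and the denominator is at most N^2.\<close>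
  define N :: nat where "N = nat \<lceil>1 + cmod w\<rceil>"
  have N: "1 + cmod w \<le> real N" unfolding N_def by linarith
  hence "real N > 0" using norm_ge_zero[of w] by linarith
  hence N0: "N > 0" by simp
  have "\<exists>q::int. \<exists>z\<in>OK. 0 < q \<and> q \<le> int (N ^ 2) \<and> cmod (of_int q * y - z) < 1" if y: "y \<in> K" for y
  proof -
    obtain a b where y: "y = of_rat a + of_rat b * w" using y K_iff by metis
    define \<theta> :: "nat \<Rightarrow> real" where "\<theta> i = (if i = 0 then of_rat a else of_rat b)" for i
    obtain q p where q: "0 < q" "q \<le> int (N ^ 2)"
      and p: "\<And>i. i < 2 \<Longrightarrow> \<bar>of_int q * \<theta> i - of_int (p i)\<bar> < 1 / N"
      using Dirichlet_approx_simult[OF N0, of 2 \<theta>] by blast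
    have p0: "\<bar>of_int q * of_rat a - of_int (p 0)\<bar> < 1 / N"
      and p1: "\<bar>of_int q * of_rat b - of_int (p 1)\<bar> < 1 / N"
      using p[of 0] p[of 1] by (auto simp: \<theta>_def)
    define z where "z = of_int (p 0) + of_int (p 1) * w"
    have z: "z \<in> OK" unfolding z_def by (intro OK_add OK_mult OK_of_int OK_w)
    have "of_int q * y - z = complex_of_real (of_int q * of_rat a - of_int (p 0))
      + complex_of_real (of_int q * of_rat b - of_int (p 1)) * w"
      by (simp add: y z_def complex_of_rat_eq algebra_simps)
    hence "cmod (of_int q * y - z) \<le> \<bar>of_int q * of_rat a - of_int (p 0)\<bar>
      + \<bar>of_int q * of_rat b - of_int (p 1)\<bar> * cmod w"
      by (metis norm_triangle_ineq norm_mult norm_of_real)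
    also have "\<dots> < 1 / N + 1 / N * cmod w"
      using p0 p1 by (intro add_less_le_mono mult_right_mono) auto
    also have "\<dots> = (1 + cmod w) / N" by (simp add: add_divide_distrib)
    also have "\<dots> \<le> 1" using N N0 by simp
    finally show ?thesis using q z by blast
  qed
  thus ?thesis using that[of "int (N ^ 2)"] N0 by simp
qed

text \<open>A common denominator \<open>c\<close> maps the elements of bounded size injectively into
  a finite set of integers of \<open>K\<close>.\<close>

lemma fractional_ideal_min:
  assumes I: "fractional_ideal K I"
  obtains x where "x \<in> I" "x \<noteq> 0" "\<And>y. y \<in> I \<Longrightarrow> y \<noteq> 0 \<Longrightarrow> cmod x \<le> cmod y"
proof -
  obtain x where x: "x \<in> I" "x \<noteq> 0" using fractional_ideal_nonzero[OF I] .
  obtain c where c: "c \<in> OK" "c \<noteq> 0" "\<And>x. x \<in> I \<Longrightarrow> c * x \<in> OK"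
    using fractional_ideal_denominator[OF I] by blast
  define S where "S = {y \<in> I. y \<noteq> 0 \<and> cmod y \<le> cmod x}"
  have "inj_on (\<lambda>y. c * y) S" using c by (auto intro!: inj_onI)
  moreover have "(\<lambda>y. c * y) ` S \<subseteq> {z \<in> OK. cmod z \<le> cmod c * cmod x}"
    using c by (auto simp: S_def norm_mult mult_left_mono)
  ultimately have "finite S"
    using finite_OK_bounded inj_on_finite by blast
  moreover have "x \<in> S" using x by (simp add: S_def)
  ultimately obtain z where z: "z \<in> S" "\<And>y. y \<in> S \<Longrightarrow> cmod z \<le> cmod y"
    by (metis arg_min_if_finite(1) arg_min_least empty_iff)
  show ?thesis
  proof (rule that[of z])
    fix y assume "y \<in> I" "y \<noteq> 0"
    thus "cmod z \<le> cmod y" using z by (cases "cmod y \<le> cmod x") (auto simp: S_def)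
  qed (use z in \<open>auto simp: S_def\<close>)
qed

text \<open>Such an ideal contains \<open>OK\<close>, hence all integer combinations of 1 and
  \<open>w\<close>. Subtracting integral parts of coordinates moves every element into the finite
  set \<open>R\<close>, so the ideal is determined by its intersection with
  \<open>R\<close>.\<close>

lemma finite_ideals_between:
  assumes M: "M > (0::int)"
  shows "finite {J. fractional_ideal K J \<and> 1 \<in> J \<and> (\<forall>y\<in>J. of_int M * y \<in> OK)}" (is "finite ?F")
proof -
  define R where "R = {y. of_int M * y \<in> OK \<and> cmod y \<le> 1 + cmod w}"
  have "inj_on (\<lambda>y. of_int M * y :: complex) R" using M by (auto intro!: inj_onI)
  moreover have "(\<lambda>y. of_int M * y) ` R \<subseteq> {z \<in> OK. cmod z \<le> of_int M * (1 + cmod w)}"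
    using M by (auto simp: R_def norm_mult mult_left_mono)
  ultimately have R: "finite R" using finite_OK_bounded inj_on_finite by blast
  have sub: "J \<subseteq> J'" if J: "J \<in> ?F" "J' \<in> ?F" "J \<inter> R = J' \<inter> R" for J J'
  proof
    fix y assume y: "y \<in> J"
    have J1: "fractional_ideal K J" "1 \<in> J" "of_int M * y \<in> OK" and J2: "fractional_ideal K J'" "1 \<in> J'"
      using J y by auto
    have "y \<in> K" using y fractional_idealD(1)[OF J1(1)] by blast
    then obtain a b where ab: "y = of_rat a + of_rat b * w" using K_iff by metis
    define z where "z = of_int \<lfloor>a\<rfloor> + of_int \<lfloor>b\<rfloor> * w"
    have z: "z \<in> OK" unfolding z_def by (intro OK_add OK_mult OK_of_int OK_w)
    have zJ: "z \<in> J" "z \<in> J'"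
      using fractional_idealD(4)[OF J1(1) z J1(2)] fractional_idealD(4)[OF J2(1) z J2(2)] by auto
    have nf: "cmod (of_rat (frac r)) \<le> 1" for r :: rat
    proof -
      have "\<bar>of_rat (frac r) :: real\<bar> \<le> 1"
        using frac_ge_0[of r] frac_lt_1[of r] by (simp add: abs_le_iff of_rat_less_eq[of _ 1, simplified] order.strict_implies_order) 
      thus ?thesis by (simp add: complex_of_rat_eq)
    qed
    have "y - z = of_rat (frac a) + of_rat (frac b) * w"
      by (simp add: ab z_def frac_def of_rat_diff algebra_simps)
    hence "cmod (y - z) \<le> cmod (of_rat (frac a)) + cmod (of_rat (frac b)) * cmod w"
      by (metis norm_triangle_ineq norm_mult)
    also have "\<dots> \<le> 1 + 1 * cmod w" by (intro add_mono mult_right_mono nf) auto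
    finally have "cmod (y - z) \<le> 1 + cmod w" by simp
    moreover have "of_int M * (y - z) \<in> OK"
      using J1(3) z by (auto simp: right_diff_distrib intro: OK_diff OK_mult OK_of_int)
    moreover have "y - z \<in> J" using fractional_ideal_diff[OF J1(1) y zJ(1)] .
    ultimately have "y - z \<in> J'" using J(3) by (auto simp: R_def)
    from fractional_idealD(3)[OF J2(1) this zJ(2)] show "y \<in> J'" by simp
  qed
  hence "inj_on (\<lambda>J. J \<inter> R) ?F" by (intro inj_onI subset_antisym) blast+
  moreover have "(\<lambda>J. J \<inter> R) ` ?F \<subseteq> Pow R" by auto
  ultimately show ?thesis using R inj_on_finite by blast
qed

text \<open>Rules out the default value 0 of \<open>class_number\<close>, for which divisibility by
  3 would be void.\<close>

lemma finite_class_group: "finite (carrier (class_group K))"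
proof -
  obtain Q :: int where Q: "Q > 0"
    "\<And>y. y \<in> K \<Longrightarrow> \<exists>q::int. \<exists>z\<in>OK. 0 < q \<and> q \<le> Q \<and> cmod (of_int q * y - z) < 1"
    using K_approximation by blast
  \<comment> \<open>A factorial is divisible by every denominator \<open>q\<close> up to
    \<open>Q\<close>, whichever occurs.\<close>
  define M :: int where "M = fact (nat Q)"
  let ?F = "{J. fractional_ideal K J \<and> 1 \<in> J \<and> (\<forall>y\<in>J. of_int M * y \<in> OK)}"
  have "carrier (class_group K) \<subseteq> (\<lambda>J. principal_ideals K #>\<^bsub>IG\<^esub> J) ` ?F"
  proof
    fix X assume "X \<in> carrier (class_group K)"
    then obtain I where I: "fractional_ideal K I" "X = principal_ideals K #>\<^bsub>IG\<^esub> I"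
      by (auto simp: class_group_def carrier_FactGroup)
    obtain x where x: "x \<in> I" "x \<noteq> 0" "\<And>y. y \<in> I \<Longrightarrow> y \<noteq> 0 \<Longrightarrow> cmod x \<le> cmod y"
      using fractional_ideal_min[OF I(1)] by blast
    define J where "J = ideal_scale (1 / x) I"
    have xK: "1 / x \<in> K" using x(1) fractional_idealD(1)[OF I(1)] by (auto intro: K_closed)
    have J: "fractional_ideal K J" unfolding J_def using x xK I by (intro fractional_ideal_scale) auto
    have one: "1 \<in> J" unfolding J_def ideal_scale_def using x by (auto intro!: image_eqI[of _ _ x])
    have "of_int M * y \<in> OK" if y: "y \<in> J" for y
    proof -
      obtain q z where qz: "z \<in> OK" "0 < q" "q \<le> Q" "cmod (of_int q * y - z) < 1"
        using Q(2)[of y] fractional_idealD(1)[OF J y] by blast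
      have mem: "of_int q * y - z \<in> J"
        using fractional_ideal_diff[OF J] fractional_idealD(4)[OF J] OK_of_int[of q] y qz(1) one
        by (metis mult.right_neutral)
      \<comment> \<open>This element of \<open>J\<close> has absolute value below 1, whereas nonzero
        elements of \<open>J\<close> have absolute value at least 1 by minimality of
        \<open>x\<close>.\<close>
      have "of_int q * y - z = 0"
      proof (rule ccontr)
        assume nz: "of_int q * y - z \<noteq> 0"
        obtain u where u: "u \<in> I" "of_int q * y - z = 1 / x * u" using mem by (auto simp: J_def ideal_scale_def)
        hence "cmod x \<le> cmod u" using nz by (intro x(3)) auto
        hence "1 \<le> cmod (1 / x * u)" using x(2) by (simp add: norm_mult norm_divide)
        thus False using u(2) qz(4) by simp
      qed
      hence "of_int q * y \<in> OK" using qz by simp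
      moreover have "q dvd M"
      proof -
        have "nat q dvd fact (nat Q)" using qz by (intro dvd_fact) auto
        hence "int (nat q) dvd int (fact (nat Q))" using int_dvd_int_iff by blast
        moreover have "int (nat q) = q" using qz by simp
        ultimately show ?thesis unfolding M_def of_nat_fact by simp
      qed
      then obtain t where "M = q * t" by auto
      hence "of_int M * y = of_int t * (of_int q * y)" by simp
      ultimately show ?thesis using OK_mult[OF OK_of_int[of t]] by metis
    qed
    hence "J \<in> ?F" using J one by blast
    moreover have "X = principal_ideals K #>\<^bsub>IG\<^esub> J"
      unfolding J_def using coset_scale[OF I(1) xK] x I by auto
    ultimately show "X \<in> (\<lambda>J. principal_ideals K #>\<^bsub>IG\<^esub> J) ` ?F" by blast
  qed
  moreover have "finite ?F" by (rule finite_ideals_between) (simp add: M_def)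
  ultimately show ?thesis using finite_surj by blast
qed

end

section \<open>An unramified cyclic cubic extension\<close>

text \<open>Axioms symmetric in the roots let facts about \<open>p1\<close> pass to
  \<open>p2\<close> and \<open>p3\<close> through \<open>rotate\<close>. \<open>odd e\<close> makes
  the cubic irreducible; \<open>D3\<close> keeps primitive cube roots of unity out of
  \<open>K\<close>.\<close>

locale unramified_cubic = imaginary_quadratic +
  fixes s e a :: int and p1 p2 p3 :: complex
  assumes s_sq: "s * s = 1" and odd_e: "odd e" and a_nonzero: "a \<noteq> 0"
    and disc: "a\<^sup>2 * D = - e * (27 * e + 4 * s)"
    and D3: "\<not> 3 dvd D"
    and p_sum: "p1 + p2 + p3 = - 2 * of_int s"
    and p_sum2: "p1 * p2 + p2 * p3 + p3 * p1 = 1"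
    and p_prod: "p1 * p2 * p3 = of_int e"
begin

lemma rotate: "unramified_cubic D s e a p2 p3 p1"
  using s_sq odd_e a_nonzero disc D3 p_sum p_sum2 p_prod
  by unfold_locales (simp_all add: ac_simps)

lemma s_sq': "of_int s * of_int s = (1::complex)"
  using s_sq by (metis of_int_1 of_int_mult)

lemma p1_cubic: "p1 ^ 3 = of_int (- 2 * s) * p1\<^sup>2 + of_int (- 1) * p1 + of_int e"
proof -
  have "p1 ^ 3 = (p1 + p2 + p3) * p1\<^sup>2 - (p1 * p2 + p2 * p3 + p3 * p1) * p1 + p1 * p2 * p3"
    by (simp add: power2_eq_square power3_eq_cube algebra_simps)
  thus ?thesis unfolding p_sum p_sum2 p_prod by simp
qed

lemma p1_algebraic_int: "algebraic_int p1"
  using p1_cubic by (rule algebraic_int_monic_cubic)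

end

context unramified_cubic
begin

lemma p_cubic:
  "p1 ^ 3 = of_int (- 2 * s) * p1\<^sup>2 + of_int (- 1) * p1 + of_int e"
  "p2 ^ 3 = of_int (- 2 * s) * p2\<^sup>2 + of_int (- 1) * p2 + of_int e"
  "p3 ^ 3 = of_int (- 2 * s) * p3\<^sup>2 + of_int (- 1) * p3 + of_int e"
  using p1_cubic unramified_cubic.p1_cubic[OF rotate]
    unramified_cubic.p1_cubic[OF unramified_cubic.rotate[OF rotate]] by blast+

lemma p_algebraic_int: "algebraic_int p1" "algebraic_int p2" "algebraic_int p3"
  using p1_algebraic_int unramified_cubic.p1_algebraic_int[OF rotate]
    unramified_cubic.p1_algebraic_int[OF unramified_cubic.rotate[OF rotate]] by blast+

text \<open>The ideal generated by the differences \<open>x - \<sigma> x\<close> of integers \<open>x\<close> is the unit ideal: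
  this is the only form in which unramifiedness enters.\<close>

lemma differences_unit_ideal:
  "(p1 - p2) * (p1 - p3) + (p2 - p1) * (p2 - p3) + (p3 - p1) * (p3 - p2) = 1"
proof -
  have "(p1 - p2) * (p1 - p3) + (p2 - p1) * (p2 - p3) + (p3 - p1) * (p3 - p2)
    = (p1 + p2 + p3) * (p1 + p2 + p3) - 3 * (p1 * p2 + p2 * p3 + p3 * p1)"
    by (simp add: algebra_simps)
  also have "\<dots> = 4 * (of_int s * of_int s) - 3" unfolding p_sum p_sum2 by simp
  finally show ?thesis by (simp add: s_sq')
qed

definition \<delta> :: complex where "\<delta> = (p1 - p2) * (p2 - p3) * (p3 - p1)"

lemma \<delta>_squared: "\<delta> * \<delta> = of_int (a\<^sup>2 * D)"
proof -
  \<comment> \<open>The discriminant of a general cubic in terms of elementary symmetric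
    functions.\<close>
  have "\<delta> * \<delta> = (p1 + p2 + p3)\<^sup>2 * (p1 * p2 + p2 * p3 + p3 * p1)\<^sup>2
    - 4 * (p1 * p2 + p2 * p3 + p3 * p1) ^ 3 - 4 * (p1 + p2 + p3) ^ 3 * (p1 * p2 * p3)
    - 27 * (p1 * p2 * p3)\<^sup>2
    + 18 * (p1 + p2 + p3) * (p1 * p2 + p2 * p3 + p3 * p1) * (p1 * p2 * p3)"
    unfolding \<delta>_def by (simp add: power2_eq_square power3_eq_cube algebra_simps)
  also have "\<dots> = 4 * (of_int s * of_int s) - 4 + 32 * of_int s * (of_int s * of_int s) * of_int e
      - 27 * of_int e * of_int e - 36 * of_int s * of_int e"
    unfolding p_sum p_sum2 p_prod by (simp add: power2_eq_square power3_eq_cube algebra_simps)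
  also have "\<dots> = of_int (- e * (27 * e + 4 * s))"
    unfolding s_sq' by (simp add: algebra_simps)
  finally show ?thesis by (simp only: disc)
qed

lemma \<delta>_nonzero: "\<delta> \<noteq> 0"
  using \<delta>_squared a_nonzero D_neg by (metis mult_eq_0_iff of_int_eq_0_iff order_less_irrefl power_not_zero)

lemma \<delta>_K: "\<delta> \<in> K"
proof -
  have "\<delta> * \<delta> = (of_int a * w) * (of_int a * w)"
    using \<delta>_squared w_squared by (simp add: power2_eq_square mult_ac)
  hence "\<delta> = of_int a * w \<or> \<delta> = - (of_int a * w)"
    by (simp add: square_eq_iff)
  thus ?thesis by (auto intro!: K_minus K_mult K_of_int K_w)
qed

lemma p_distinct: "p1 \<noteq> p2" "p2 \<noteq> p3" "p3 \<noteq> p1"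
  using \<delta>_nonzero by (auto simp: \<delta>_def)

text \<open>\<open>triple F x y z\<close> holds if \<open>x, y, z\<close> are the conjugates over \<open>F\<close> of an element of \<open>F(p\<^sub>1)\<close>.
  Since \<open>F = K\<close> contains the root \<open>\<delta>\<close> of the discriminant, cyclic rotation preserves these triples
  and plays the role of the Galois group.\<close>

definition triple :: "complex set \<Rightarrow> complex \<Rightarrow> complex \<Rightarrow> complex \<Rightarrow> bool" where
  "triple F x y z \<longleftrightarrow> (\<exists>c0\<in>F. \<exists>c1\<in>F. \<exists>c2\<in>F. x = c0 + c1 * p1 + c2 * p1\<^sup>2 \<and>
     y = c0 + c1 * p2 + c2 * p2\<^sup>2 \<and> z = c0 + c1 * p3 + c2 * p3\<^sup>2)"

text \<open>Two instances matter: \<open>K\<close>, where triples can be rotated, and \<rat>, which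
  makes norms of elements of Z[p1] rational integers.\<close>

definition rat_subring :: "complex set \<Rightarrow> bool" where
  "rat_subring F \<longleftrightarrow> \<rat> \<subseteq> F \<and> (\<forall>x\<in>F. \<forall>y\<in>F. x + y \<in> F \<and> x - y \<in> F \<and> x * y \<in> F)"

lemma rat_subring_K: "rat_subring K" and rat_subring_Rats: "rat_subring \<rat>"
  by (auto simp: rat_subring_def K_Rats K_closed)

lemma rat_subringD:
  assumes "rat_subring F"
  shows "x \<in> F \<Longrightarrow> y \<in> F \<Longrightarrow> x + y \<in> F" "x \<in> F \<Longrightarrow> y \<in> F \<Longrightarrow> x - y \<in> F"
    "x \<in> F \<Longrightarrow> y \<in> F \<Longrightarrow> x * y \<in> F" "x \<in> F \<Longrightarrow> x / numeral k \<in> F"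
    "of_int n \<in> F" "numeral k \<in> F" "0 \<in> F" "1 \<in> F"
proof -
  have Q: "q \<in> F" if "q \<in> \<rat>" for q using assms that unfolding rat_subring_def by blast
  show m: "x \<in> F \<Longrightarrow> y \<in> F \<Longrightarrow> x * y \<in> F" for x y using assms unfolding rat_subring_def by blast
  have "(1 / numeral k :: complex) \<in> \<rat>" by simp
  from m[OF _ Q[OF this]] show "x \<in> F \<Longrightarrow> x / numeral k \<in> F" by simp
  show "of_int n \<in> F" "numeral k \<in> F" "0 \<in> F" "1 \<in> F" by (simp_all add: Q)
qed (use assms in \<open>auto simp: rat_subring_def\<close>)

lemma triple_const: "rat_subring F \<Longrightarrow> c \<in> F \<Longrightarrow> triple F c c c"
  unfolding triple_def by (rule bexI[of _ c], rule bexI[of _ 0], rule bexI[of _ 0]) (auto simp: rat_subringD)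

lemma triple_p: "rat_subring F \<Longrightarrow> triple F p1 p2 p3"
  unfolding triple_def by (rule bexI[of _ 0], rule bexI[of _ 1], rule bexI[of _ 0]) (auto simp: rat_subringD)

lemma triple_add:
  assumes F: "rat_subring F" and "triple F x y z" "triple F x' y' z'"
  shows "triple F (x + x') (y + y') (z + z')"
proof -
  obtain c0 c1 c2 d0 d1 d2 where F': "c0 \<in> F" "c1 \<in> F" "c2 \<in> F" "d0 \<in> F" "d1 \<in> F" "d2 \<in> F"
    and eq: "x = c0 + c1 * p1 + c2 * p1\<^sup>2" "y = c0 + c1 * p2 + c2 * p2\<^sup>2" "z = c0 + c1 * p3 + c2 * p3\<^sup>2"
      "x' = d0 + d1 * p1 + d2 * p1\<^sup>2" "y' = d0 + d1 * p2 + d2 * p2\<^sup>2" "z' = d0 + d1 * p3 + d2 * p3\<^sup>2"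
    using assms(2,3) unfolding triple_def by blast
  show ?thesis unfolding triple_def
    by (rule bexI[of _ "c0 + d0"], rule bexI[of _ "c1 + d1"], rule bexI[of _ "c2 + d2"])
       (auto simp: eq algebra_simps intro!: rat_subringD(1)[OF F] F')
qed

text \<open>Reduce the third and fourth powers modulo the cubic, using that \<open>s\<close> squares
  to 1; the coefficients \<open>r0\<close>, \<open>r1\<close>, \<open>r2\<close> do not depend on
  the root.\<close>

lemma triple_mult:
  assumes F: "rat_subring F" and "triple F x y z" "triple F x' y' z'"
  shows "triple F (x * x') (y * y') (z * z')"
proof -
  obtain c0 c1 c2 d0 d1 d2 where F': "c0 \<in> F" "c1 \<in> F" "c2 \<in> F" "d0 \<in> F" "d1 \<in> F" "d2 \<in> F"
    and eq: "x = c0 + c1 * p1 + c2 * p1\<^sup>2" "y = c0 + c1 * p2 + c2 * p2\<^sup>2" "z = c0 + c1 * p3 + c2 * p3\<^sup>2"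
      "x' = d0 + d1 * p1 + d2 * p1\<^sup>2" "y' = d0 + d1 * p2 + d2 * p2\<^sup>2" "z' = d0 + d1 * p3 + d2 * p3\<^sup>2"
    using assms(2,3) unfolding triple_def by blast
  define S E where "S = (of_int s :: complex)" and "E = (of_int e :: complex)"
  define m where "m = c1 * d2 + c2 * d1"
  define r0 where "r0 = c0 * d0 + m * E - 2 * S * E * (c2 * d2)"
  define r1 where "r1 = c0 * d1 + c1 * d0 - m + (E + 2 * S) * (c2 * d2)"
  define r2 where "r2 = c0 * d2 + c1 * d1 + c2 * d0 - 2 * S * m + 3 * (c2 * d2)"
  have SE: "S \<in> F" "E \<in> F" by (auto simp: S_def E_def rat_subringD[OF F])
  have m: "m \<in> F" unfolding m_def by (intro rat_subringD[OF F] F')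
  have r: "r0 \<in> F" "r1 \<in> F" "r2 \<in> F"
    unfolding r0_def r1_def r2_def by (intro rat_subringD[OF F] F' m SE)+
  have *: "(c0 + c1 * p + c2 * p\<^sup>2) * (d0 + d1 * p + d2 * p\<^sup>2) = r0 + r1 * p + r2 * p\<^sup>2"
    if p: "p ^ 3 = of_int (- 2 * s) * p\<^sup>2 + of_int (- 1) * p + of_int e" for p
  proof -
    have p3: "p ^ 3 = - 2 * S * p\<^sup>2 - p + E" using p by (simp add: S_def E_def)
    have "p * p ^ 3 = - 2 * S * p ^ 3 - p\<^sup>2 + E * p"
      by (subst p3) (simp add: power2_eq_square power3_eq_cube algebra_simps)
    also have "\<dots> = 4 * (S * S) * p\<^sup>2 + 2 * S * p - 2 * S * E - p\<^sup>2 + E * p"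
      by (simp add: p3 algebra_simps)
    also have "\<dots> = - 2 * S * E + (E + 2 * S) * p + 3 * p\<^sup>2"
      unfolding S_def s_sq' by (simp add: algebra_simps)
    finally have p4: "p * p ^ 3 = - 2 * S * E + (E + 2 * S) * p + 3 * p\<^sup>2" .
    have "(c0 + c1 * p + c2 * p\<^sup>2) * (d0 + d1 * p + d2 * p\<^sup>2)
      = c0 * d0 + (c0 * d1 + c1 * d0) * p + (c0 * d2 + c1 * d1 + c2 * d0) * p\<^sup>2
        + m * p ^ 3 + c2 * d2 * (p * p ^ 3)"
      by (simp add: m_def power2_eq_square power3_eq_cube algebra_simps)
    also have "\<dots> = r0 + r1 * p + r2 * p\<^sup>2"
      unfolding p4 unfolding p3 r0_def r1_def r2_def by (simp add: algebra_simps)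
    finally show ?thesis .
  qed
  show ?thesis unfolding triple_def eq
    by (rule bexI[OF _ r(1)], rule bexI[OF _ r(2)], rule bexI[OF _ r(3)]) (intro conjI * p_cubic)
qed

lemma triple_cmult:
  "rat_subring F \<Longrightarrow> c \<in> F \<Longrightarrow> triple F x y z \<Longrightarrow> triple F (c * x) (c * y) (c * z)"
  using triple_mult[OF _ triple_const] by blast

lemma triple_power: "rat_subring F \<Longrightarrow> triple F x y z \<Longrightarrow> triple F (x ^ n) (y ^ n) (z ^ n)"
  by (induction n) (auto intro: triple_mult triple_const simp: rat_subringD)

lemma triple_sum:
  assumes F: "rat_subring F" and "triple F x y z"
  shows "x + y + z \<in> F"
proof -
  obtain c0 c1 c2 where F': "c0 \<in> F" "c1 \<in> F" "c2 \<in> F"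
    and eq: "x = c0 + c1 * p1 + c2 * p1\<^sup>2" "y = c0 + c1 * p2 + c2 * p2\<^sup>2" "z = c0 + c1 * p3 + c2 * p3\<^sup>2"
    using assms(2) unfolding triple_def by blast
  have "x + y + z = 3 * c0 + c1 * (p1 + p2 + p3)
      + c2 * ((p1 + p2 + p3) * (p1 + p2 + p3) - 2 * (p1 * p2 + p2 * p3 + p3 * p1))"
    by (simp add: eq power2_eq_square algebra_simps)
  also have "\<dots> = 3 * c0 + c1 * of_int (- 2 * s) + c2 * (of_int (4 * s * s) - 2)"
    unfolding p_sum p_sum2 by simp
  also have "\<dots> \<in> F" by (intro rat_subringD[OF F] F')
  finally show ?thesis .
qed

text \<open>Newton's identities reduce everything to traces of powers; the divisions by 2 and 6 are
  possible because \<open>F\<close> contains \<rat>.\<close>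

lemma triple_elementary_symmetric:
  assumes F: "rat_subring F" and t: "triple F x y z"
  shows "x * y + y * z + z * x \<in> F" "x * y * z \<in> F"
proof -
  define P1 P2 P3 where "P1 = x + y + z" and "P2 = x ^ 2 + y ^ 2 + z ^ 2" and "P3 = x ^ 3 + y ^ 3 + z ^ 3"
  have P: "P1 \<in> F" "P2 \<in> F" "P3 \<in> F"
    unfolding P1_def P2_def P3_def by (intro triple_sum[OF F] triple_power[OF F] t)+
  have "x * y + y * z + z * x = (P1 * P1 - P2) / 2"
    by (simp add: P1_def P2_def power2_eq_square algebra_simps)
  also have "\<dots> \<in> F" by (intro rat_subringD[OF F] P)
  finally show "x * y + y * z + z * x \<in> F" .
  have "x * y * z = (P1 * P1 * P1 - 3 * (P1 * P2) + 2 * P3) / 6"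
    by (simp add: P1_def P2_def P3_def power2_eq_square power3_eq_cube algebra_simps)
  also have "\<dots> \<in> F" by (intro rat_subringD[OF F] P)
  finally show "x * y * z \<in> F" .
qed

text \<open>The left side is the square of \<open>p2 - p3\<close> times minus the derivative of the
  cubic at \<open>p1\<close>; both are symmetric in \<open>p2\<close> and \<open>p3\<close>, hence
  polynomials in \<open>p1\<close>.\<close>

lemma \<delta>_difference: "\<delta> * (p2 - p3) = (3 * p1\<^sup>2 + 4 * of_int s * p1) * (3 * p1\<^sup>2 + 4 * of_int s * p1 + 1)"
proof -
  define \<sigma> \<pi> where "\<sigma> = p2 + p3" and "\<pi> = p2 * p3"
  have \<sigma>: "\<sigma> = - 2 * of_int s - p1" using p_sum by (simp add: \<sigma>_def algebra_simps)
  have "\<pi> = 1 - p1 * \<sigma>" using p_sum2 by (simp add: \<sigma>_def \<pi>_def algebra_simps)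
  hence \<pi>: "\<pi> = 1 + 2 * of_int s * p1 + p1\<^sup>2" by (simp add: \<sigma> power2_eq_square algebra_simps)
  have "\<delta> * (p2 - p3) = (\<sigma> * \<sigma> - 4 * \<pi>) * (- (p1\<^sup>2 - p1 * \<sigma> + \<pi>))"
    by (simp add: \<delta>_def \<sigma>_def \<pi>_def power2_eq_square algebra_simps)
  also have "\<sigma> * \<sigma> - 4 * \<pi> = 4 * (of_int s * of_int s) - 4 - 4 * of_int s * p1 - 3 * p1\<^sup>2"
    by (simp add: \<sigma> \<pi> power2_eq_square algebra_simps)
  also have "\<dots> = - (3 * p1\<^sup>2 + 4 * of_int s * p1)" unfolding s_sq' by simp
  also have "- (p1\<^sup>2 - p1 * \<sigma> + \<pi>) = - (3 * p1\<^sup>2 + 4 * of_int s * p1 + 1)"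
    by (simp add: \<sigma> \<pi> power2_eq_square algebra_simps)
  finally show ?thesis by (simp only: minus_mult_minus)
qed

text \<open>The generator \<sigma> as a polynomial over \<open>K\<close>: half of
  \<open>p2 + p3\<close> plus half of \<open>p2 - p3\<close>, each expressed by \<open>p1\<close>.
  Only sums, products, powers and constants occur, so the closure rules for \<open>triple\<close>
  apply to it directly.\<close>

definition rot :: "complex \<Rightarrow> complex" where
  "rot x = (- 1 / 2) * (of_int (2 * s) + x +
     (- 1 / \<delta>) * ((3 * x\<^sup>2 + of_int (4 * s) * x) * (3 * x\<^sup>2 + of_int (4 * s) * x + 1)))"

lemma rot_p1: "rot p1 = p2"
proof -
  have "(- 1 / \<delta>) * ((3 * p1\<^sup>2 + of_int (4 * s) * p1) * (3 * p1\<^sup>2 + of_int (4 * s) * p1 + 1)) = - (p2 - p3)"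
  proof -
    have "(- 1 / \<delta>) * (\<delta> * (p2 - p3)) = - (p2 - p3)" using \<delta>_nonzero by simp
    thus ?thesis unfolding \<delta>_difference by simp
  qed
  hence "rot p1 = (- 1 / 2) * (of_int (2 * s) + p1 + - (p2 - p3))" unfolding rot_def by simp
  also have "of_int (2 * s) = - (p1 + p2 + p3)" by (simp add: p_sum)
  finally show ?thesis by (simp add: algebra_simps)
qed

lemma \<delta>_rotate: "unramified_cubic.\<delta> p2 p3 p1 = \<delta>"
  by (simp add: \<delta>_def unramified_cubic.\<delta>_def[OF rotate] mult_ac)

end

context unramified_cubic
begin

text \<open>As \<delta> is invariant under cyclic rotation, one and the same polynomial carries each
  root to the next.\<close>

lemma rot_rotate: "unramified_cubic.rot s p2 p3 p1 = rot"
  by (intro ext) (simp add: rot_def unramified_cubic.rot_def[OF rotate] \<delta>_rotate)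

lemma rot_p: "rot p1 = p2" "rot p2 = p3" "rot p3 = p1"
proof -
  interpret r: unramified_cubic D s e a p2 p3 p1 by (rule rotate)
  show "rot p2 = p3" using r.rot_p1 rot_rotate by simp
  show "rot p3 = p1" using unramified_cubic.rot_p1[OF r.rotate] r.rot_rotate rot_rotate by simp
qed (rule rot_p1)

lemma triple_p_rotate: "triple K p2 p3 p1"
proof -
  note R = rat_subring_K
  have "triple K (rot p1) (rot p2) (rot p3)"
    unfolding rot_def
    by (intro triple_add[OF R] triple_mult[OF R] triple_const[OF R] triple_power[OF R] triple_p[OF R]
        K_closed \<delta>_K)
  thus ?thesis by (simp add: rot_p)
qed

lemma triple_rotate: assumes "triple K x y z" shows "triple K y z x"
proof -
  note R = rat_subring_K
  obtain c0 c1 c2 where F': "c0 \<in> K" "c1 \<in> K" "c2 \<in> K"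
    and eq: "x = c0 + c1 * p1 + c2 * p1\<^sup>2" "y = c0 + c1 * p2 + c2 * p2\<^sup>2" "z = c0 + c1 * p3 + c2 * p3\<^sup>2"
    using assms unfolding triple_def by blast
  show ?thesis unfolding eq
    by (intro triple_add[OF R] triple_mult[OF R] triple_const[OF R] triple_power[OF R] triple_p_rotate F')
qed

section \<open>Units of relative norm 1\<close>

text \<open>The inverses are integral as well, being products of the other two conjugates.\<close>

definition unit_triple :: "complex \<Rightarrow> complex \<Rightarrow> complex \<Rightarrow> bool" where
  "unit_triple u1 u2 u3 \<longleftrightarrow> triple K u1 u2 u3 \<and>
     algebraic_int u1 \<and> algebraic_int u2 \<and> algebraic_int u3 \<and> u1 * u2 * u3 = 1"

text \<open>The classical resolvent of \<open>p1 ^ j\<close>, namely y + u \<sigma>(y) + u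
  \<sigma>(u) \<sigma>^2(y); it is integral because \<open>u\<close> and the roots are.\<close>

lemma hilbert90_integral:
  assumes u: "unit_triple u1 u2 u3"
  obtains b1 b2 b3 where "triple K b1 b2 b3" "algebraic_int b1" "algebraic_int b2" "algebraic_int b3"
    "b1 \<noteq> 0" "b1 = u1 * b2" "b2 = u2 * b3" "b3 = u3 * b1"
proof -
  note R = rat_subring_K
  have t: "triple K u1 u2 u3" and i: "algebraic_int u1" "algebraic_int u2" "algebraic_int u3"
    and n: "u1 * u2 * u3 = 1" using u by (auto simp: unit_triple_def)
  have t': "triple K u2 u3 u1" and q': "triple K p2 p3 p1" using t triple_rotate triple_p_rotate by auto
  have q'': "triple K p3 p1 p2" using q' triple_rotate by blast
  define B1 B2 B3 where
    "B1 j = p1 ^ j + u1 * p2 ^ j + u1 * u2 * p3 ^ j" and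
    "B2 j = p2 ^ j + u2 * p3 ^ j + u2 * u3 * p1 ^ j" and
    "B3 j = p3 ^ j + u3 * p1 ^ j + u3 * u1 * p2 ^ j" for j :: nat
  \<comment> \<open>The polynomial (X - p2)(X - p3) annihilates two of the three terms, so the
    resolvents for j = 0, 1, 2 cannot all vanish.\<close>
  have "B1 2 - (p2 + p3) * B1 1 + p2 * p3 * B1 0 = (p1 - p2) * (p1 - p3)"
    by (simp add: B1_def power2_eq_square algebra_simps)
  moreover have "(p1 - p2) * (p1 - p3) \<noteq> 0" using p_distinct by auto
  ultimately obtain j where j: "B1 j \<noteq> 0" by (metis diff_zero add_0 mult_zero_right)
  show ?thesis
  proof (rule that[of "B1 j" "B2 j" "B3 j"])
    show "triple K (B1 j) (B2 j) (B3 j)"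
      unfolding B1_def B2_def B3_def
      by (intro triple_add[OF R] triple_mult[OF R] triple_power[OF R] t t' triple_p[OF R] q' q'')
    show "algebraic_int (B1 j)" "algebraic_int (B2 j)" "algebraic_int (B3 j)"
      unfolding B1_def B2_def B3_def by (intro algebraic_int_closed i p_algebraic_int)+
    have n': "u2 * u3 * u1 = 1" "u3 * u1 * u2 = 1" using n by (simp_all add: mult_ac)
    have "u1 * B2 j = (u1 * u2 * u3) * p1 ^ j + u1 * p2 ^ j + u1 * u2 * p3 ^ j"
      by (simp add: B2_def algebra_simps)
    thus "B1 j = u1 * B2 j" by (simp add: n B1_def)
    have "u2 * B3 j = (u2 * u3 * u1) * p2 ^ j + u2 * p3 ^ j + u2 * u3 * p1 ^ j"
      by (simp add: B3_def algebra_simps)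
    thus "B2 j = u2 * B3 j" by (simp add: n' B2_def)
    have "u3 * B1 j = (u3 * u1 * u2) * p3 ^ j + u3 * p1 ^ j + u3 * u1 * p2 ^ j"
      by (simp add: B1_def algebra_simps)
    thus "B3 j = u3 * B1 j" by (simp add: n' B3_def)
  qed (rule j)
qed

text \<open>The argument of Hilbert's Theorem 94: by Theorem 90, \<open>u = b / \<sigma> b\<close>; the ideal of \<open>b\<close> is extended
  from an ideal of \<open>K\<close>, generated by the traces of \<open>b p\<^sub>1\<^sup>l\<close>, whose cube is principal.
  If that ideal is itself generated by some \<open>c\<close>, then \<open>b / c\<close> is a unit.\<close>

lemma hilbert94:
  assumes h: "\<not> 3 dvd class_number K" and u: "unit_triple u1 u2 u3"
  obtains x1 x2 x3 where "unit_triple x1 x2 x3" "x1 = u1 * x2" "x2 = u2 * x3" "x3 = u3 * x1"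
proof -
  note R = rat_subring_K
  let ?A = "Collect algebraic_int :: complex set"
  have i: "algebraic_int u1" "algebraic_int u2" "algebraic_int u3"
    and n: "u1 * u2 * u3 = 1" using u by (auto simp: unit_triple_def)
  obtain b1 b2 b3 where b: "triple K b1 b2 b3"
    and bi: "algebraic_int b1" "algebraic_int b2" "algebraic_int b3"
    and b0: "b1 \<noteq> 0" and bu: "b1 = u1 * b2" "b2 = u2 * b3" "b3 = u3 * b1"
    using hilbert90_integral[OF u] .
  have b2: "b2 = u2 * u3 * b1" using bu by simp
  define S where "S l = b1 * p1 ^ l + b2 * p2 ^ l + b3 * p3 ^ l" for l :: nat
  \<comment> \<open>The quotient \<open>S l / b1\<close>, written so that integrality is visible:
    \<open>b2\<close> and \<open>b3\<close> are unit multiples of \<open>b1\<close>.\<close>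
  define r where "r l = p1 ^ l + u2 * u3 * p2 ^ l + u3 * p3 ^ l" for l :: nat
  have S_OK: "S l \<in> OK" for l
    unfolding OK_iff S_def
    by (intro conjI triple_sum[OF R] triple_mult[OF R] triple_power[OF R] triple_p[OF R] b
        algebraic_int_closed bi p_algebraic_int)
  have r_int: "algebraic_int (r l)" for l
    unfolding r_def by (intro algebraic_int_closed i p_algebraic_int)
  have S_r: "S l = b1 * r l" for l
    unfolding S_def r_def by (subst bu(3), subst b2) (simp add: algebra_simps)
  \<comment> \<open>Interpolation with (X - p2)(X - p3) and its rotations isolates each conjugate of
    \<open>b\<close> from the traces \<open>S\<close>. Weights 1, \<open>u1\<close>,
    \<open>u1 * u2\<close> turn all three into multiples of \<open>b1\<close>, whose factors sum to
    1 by \<open>differences_unit_ideal\<close>.\<close>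
  define c0 where "c0 = p2 * p3 + u1 * (p3 * p1) + u1 * u2 * (p1 * p2)"
  define c1 where "c1 = - (p2 + p3) - u1 * (p3 + p1) - u1 * u2 * (p1 + p2)"
  define c2 where "c2 = 1 + u1 + u1 * u2"
  have c_int: "algebraic_int c0" "algebraic_int c1" "algebraic_int c2"
    unfolding c0_def c1_def c2_def by (intro algebraic_int_closed i p_algebraic_int)+
  have b_span: "b1 = c0 * S 0 + c1 * S 1 + c2 * S 2"
  proof -
    have b1': "b1 = u1 * u2 * b3" using bu by simp
    have L1: "(p1 - p2) * (p1 - p3) * b1 = S 2 - (p2 + p3) * S 1 + p2 * p3 * S 0"
      and L2: "(p2 - p1) * (p2 - p3) * b2 = S 2 - (p3 + p1) * S 1 + p3 * p1 * S 0"
      and L3: "(p3 - p1) * (p3 - p2) * b3 = S 2 - (p1 + p2) * S 1 + p1 * p2 * S 0"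
      by (simp_all add: S_def power2_eq_square algebra_simps)
    have "b1 = ((p1 - p2) * (p1 - p3) + (p2 - p1) * (p2 - p3) + (p3 - p1) * (p3 - p2)) * b1"
      by (simp add: differences_unit_ideal)
    also have "\<dots> = (p1 - p2) * (p1 - p3) * b1 + (p2 - p1) * (p2 - p3) * (u1 * b2)
        + (p3 - p1) * (p3 - p2) * (u1 * u2 * b3)"
      by (simp only: bu(1)[symmetric] b1'[symmetric] distrib_right)
    also have "\<dots> = (p1 - p2) * (p1 - p3) * b1 + u1 * ((p2 - p1) * (p2 - p3) * b2)
        + u1 * u2 * ((p3 - p1) * (p3 - p2) * b3)"
      by (simp only: mult_ac)
    also have "\<dots> = c0 * S 0 + c1 * S 1 + c2 * S 2"
      unfolding L1 L2 L3 c0_def c1_def c2_def by (simp add: algebra_simps)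
    finally show ?thesis .
  qed
  define I where "I = {x0 * S 0 + x1 * S 1 + x2 * S 2 | x0 x1 x2. x0 \<in> OK \<and> x1 \<in> OK \<and> x2 \<in> OK}"
  have I_memI: "x0 * S 0 + x1 * S 1 + x2 * S 2 \<in> I" if "x0 \<in> OK" "x1 \<in> OK" "x2 \<in> OK" for x0 x1 x2
    using that unfolding I_def by blast
  have S_I: "S 0 \<in> I" "S 1 \<in> I" "S 2 \<in> I"
    using I_memI[of 1 0 0] I_memI[of 0 1 0] I_memI[of 0 0 1] by (simp_all add: OK_0 OK_1)
  have I_OK: "I \<subseteq> OK" unfolding I_def by (auto intro!: OK_add OK_mult S_OK)
  have I: "fractional_ideal K I"
  proof -
    have "\<exists>x \<in> I. x \<noteq> 0" using b_span b0 S_I by (metis add_0 mult_zero_right)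
    then obtain x where x: "x \<in> I" "x \<noteq> 0" by blast
    show ?thesis
    proof (rule fractional_idealI[OF _ _ x])
      show "0 \<in> I" using I_memI[of 0 0 0] by (simp add: OK_0)
      fix y z assume "y \<in> I" "z \<in> I"
      then obtain y0 y1 y2 z0 z1 z2 where
        "y = y0 * S 0 + y1 * S 1 + y2 * S 2" "z = z0 * S 0 + z1 * S 1 + z2 * S 2"
        "y0 \<in> OK" "y1 \<in> OK" "y2 \<in> OK" "z0 \<in> OK" "z1 \<in> OK" "z2 \<in> OK" unfolding I_def by blast
      thus "y + z \<in> I" using I_memI[of "y0 + z0" "y1 + z1" "y2 + z2"]
        by (simp add: OK_add algebra_simps)
    next
      fix q z assume "q \<in> OK" "z \<in> I"
      then obtain z0 z1 z2 where "z = z0 * S 0 + z1 * S 1 + z2 * S 2"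
        "z0 \<in> OK" "z1 \<in> OK" "z2 \<in> OK" unfolding I_def by blast
      thus "q * z \<in> I" using I_memI[of "q * z0" "q * z1" "q * z2"] \<open>q \<in> OK\<close>
        by (simp add: OK_mult algebra_simps)
    qed (use I_OK OK_1 OK_subset_K in auto)
  qed
  have I_div: "algebraic_int (x / b1)" if x: "x \<in> I" for x
  proof -
    obtain x0 x1 x2 where x: "x = x0 * S 0 + x1 * S 1 + x2 * S 2"
      "x0 \<in> OK" "x1 \<in> OK" "x2 \<in> OK" using x unfolding I_def by blast
    have "x / b1 = x0 * r 0 + x1 * r 1 + x2 * r 2" using b0 by (simp add: x(1) S_r add_divide_distrib)
    also have "algebraic_int \<dots>" using x by (intro algebraic_int_closed r_int) (auto simp: OK_iff)
    finally show ?thesis .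
  qed
  \<comment> \<open>The norm of \<open>b\<close> is a unit times \<open>b1 ^ 3\<close>, and
    \<open>I\<close> and \<open>b1\<close> have the same span over the algebraic integers; so
    \<open>g\<close> should generate the cube of \<open>I\<close>.\<close>
  define g where "g = b1 * b2 * b3"
  have u0: "u1 \<noteq> 0" "u2 \<noteq> 0" "u3 \<noteq> 0" using n by auto
  have g_b: "g = u2 * u3 * u3 * b1 ^ 3"
    unfolding g_def by (subst bu(3), subst b2) (simp add: power3_eq_cube)
  have g: "g \<in> K" "g \<noteq> 0"
    using triple_elementary_symmetric(2)[OF R b] b0 u0 by (auto simp: g_def[symmetric] g_b)
  have g_inv: "b1 ^ 3 / g = u1 * u1 * u2"
  proof -
    have "u1 * u1 * u2 * g = (u1 * u2 * u3) * (u1 * u2 * u3) * b1 ^ 3" by (simp add: g_b)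
    thus ?thesis using g by (simp add: n divide_eq_eq)
  qed
  let ?I3 = "ideal_mult I (ideal_mult I I)"
  have I3: "fractional_ideal K ?I3" by (intro fractional_ideal_mult I)
  have "?I3 = ideal_scale g OK"
  proof
    show "?I3 \<subseteq> ideal_scale g OK"
    proof -
      have "ideal_mult I I \<subseteq> {x. algebraic_int (x / b1\<^sup>2)}"
      proof (rule ideal_mult_least)
        fix x y assume "x \<in> I" "y \<in> I"
        hence "algebraic_int ((x / b1) * (y / b1))" by (intro algebraic_int_times I_div)
        thus "x * y \<in> {x. algebraic_int (x / b1\<^sup>2)}" by (simp add: power2_eq_square)
      qed (auto simp: add_divide_distrib intro: algebraic_int_plus)
      hence "?I3 \<subseteq> {x. algebraic_int (x / b1 ^ 3)}"
      proof (intro ideal_mult_least)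
        fix x y assume "x \<in> I" "y \<in> ideal_mult I I" "ideal_mult I I \<subseteq> {x. algebraic_int (x / b1\<^sup>2)}"
        hence "algebraic_int ((x / b1) * (y / b1\<^sup>2))" by (intro algebraic_int_times I_div) auto
        thus "x * y \<in> {x. algebraic_int (x / b1 ^ 3)}"
          by (simp add: power2_eq_square power3_eq_cube mult.assoc)
      qed (auto simp: add_divide_distrib intro: algebraic_int_plus)
      moreover have "algebraic_int (x / g)" if "algebraic_int (x / b1 ^ 3)" for x
      proof -
        have "x / g = (x / b1 ^ 3) * (b1 ^ 3 / g)" using b0 by simp
        hence eq: "x / g = (x / b1 ^ 3) * (u1 * u1 * u2)" by (simp only: g_inv)
        show ?thesis unfolding eq by (intro algebraic_int_times i that)
      qed
      ultimately have "algebraic_int (x / g) \<and> x / g \<in> K" if "x \<in> ?I3" for x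
        using that fractional_idealD(1)[OF I3 that] g by (auto intro: K_divide)
      hence "x / g \<in> OK" if "x \<in> ?I3" for x using that by (simp add: OK_iff)
      thus ?thesis unfolding ideal_scale_def using g(2) by (intro subsetI image_eqI[of _ _ "_ / g"]) auto
    qed
    \<comment> \<open>For the converse inclusion, place \<open>g\<close> in the span of the cube of
      \<open>I\<close> over the algebraic integers, collecting all integral factors in front, and
      contract to \<open>K\<close>.\<close>
    have "b1 \<in> ideal_mult ?A I"
      by (subst b_span) (intro ideal_mult_add ideal_mult_prod S_I CollectI c_int)
    hence "(u2 * u3 * u3) * (b1 * (b1 * b1)) \<in> ideal_mult ?A (ideal_mult (ideal_mult ?A I) (ideal_mult (ideal_mult ?A I) (ideal_mult ?A I)))"
      by (intro ideal_mult_prod CollectI algebraic_int_closed i)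
    also have "\<dots> \<subseteq> ideal_mult ?A ?I3"
    proof -
      have AA: "ideal_mult ?A ?A \<subseteq> ?A"
        by (rule ideal_mult_least) (auto intro: algebraic_int_closed)
      have AAX: "ideal_mult ?A (ideal_mult ?A X) \<subseteq> ideal_mult ?A X" for X
        unfolding ideal_mult_assoc[symmetric] by (intro ideal_mult_mono AA order_refl)
      have push: "ideal_mult (ideal_mult ?A X) (ideal_mult ?A Y) \<subseteq> ideal_mult ?A (ideal_mult X Y)" for X Y
      proof -
        have "ideal_mult (ideal_mult ?A X) (ideal_mult ?A Y) = ideal_mult ?A (ideal_mult ?A (ideal_mult X Y))"
          by (metis ideal_mult_assoc ideal_mult_commute)
        thus ?thesis using AAX by simp
      qed
      show ?thesis
        by (meson AAX push ideal_mult_mono order_refl order_trans)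
    qed
    finally have "g \<in> ideal_mult ?A ?I3" by (simp add: g_b power3_eq_cube mult.assoc)
    hence "g \<in> ?I3" using mem_ideal_if_mem_algebraic_int_span[OF I3 g(1)] by blast
    thus "ideal_scale g OK \<subseteq> ?I3"
      using fractional_idealD(4)[OF I3] by (auto simp: ideal_scale_def mult.commute)
  qed
  then obtain c where c: "c \<in> K" "c \<noteq> 0" "I = ideal_scale c OK"
    using principal_if_cube_principal[OF h I g] by blast
  have "c \<in> I" using c OK_1 unfolding ideal_scale_def by (auto intro!: image_eqI[of _ _ 1])
  hence cb: "algebraic_int (c / b1)" by (rule I_div)
  have "algebraic_int (b1 / c)"
  proof -
    have Ic: "algebraic_int (x / c)" if "x \<in> I" for x using that c by (auto simp: ideal_scale_def OK_iff)
    have "algebraic_int (c0 * (S 0 / c) + c1 * (S 1 / c) + c2 * (S 2 / c))"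
      by (intro algebraic_int_plus algebraic_int_times c_int Ic S_I)
    thus ?thesis using b_span by (simp add: add_divide_distrib)
  qed
  hence xi: "algebraic_int (b1 / c)" "algebraic_int (b2 / c)" "algebraic_int (b3 / c)"
    using algebraic_int_times[of "u3" "b1 / c"] algebraic_int_times[of "u2 * u3" "b1 / c"]
      algebraic_int_times[OF i(2,3)] i bu(3) b2 by auto
  have xt: "triple K (b1 / c) (b2 / c) (b3 / c)"
    using triple_cmult[OF R K_divide[OF K_1 c(1)] b] by simp
  \<comment> \<open>Norm of the unit \<open>b1 / c\<close>; its inverse \<epsilon>' is integral too,
    so \<epsilon> is a unit of \<open>K\<close>.\<close>
  define \<epsilon> where "\<epsilon> = g / c ^ 3"
  define \<epsilon>' where "\<epsilon>' = c ^ 3 / g"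
  have \<epsilon>N: "\<epsilon> = (b1 / c) * (b2 / c) * (b3 / c)" by (simp add: \<epsilon>_def g_def power3_eq_cube)
  have "\<epsilon>' = (c / b1) ^ 3 * (b1 ^ 3 / g)" using b0 by (simp add: \<epsilon>'_def power_divide)
  also have "\<dots> = (c / b1) ^ 3 * (u1 * u1 * u2)" unfolding g_inv ..
  finally have "\<epsilon>' = (c / b1) ^ 3 * (u1 * u1 * u2)" .
  hence "algebraic_int \<epsilon>'" using cb i by (auto intro!: algebraic_int_closed)
  hence "\<epsilon>' \<in> OK" using c g by (auto simp: OK_iff \<epsilon>'_def intro!: K_closed)
  moreover have \<epsilon>: "\<epsilon> \<in> OK" "\<epsilon> \<in> K"
  proof -
    show "\<epsilon> \<in> K" unfolding \<epsilon>_def by (intro K_closed c g)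
    moreover have "algebraic_int \<epsilon>" unfolding \<epsilon>N by (intro algebraic_int_times xi)
    ultimately show "\<epsilon> \<in> OK" by (simp add: OK_iff)
  qed
  moreover have "\<epsilon> * \<epsilon>' = 1" using c g by (simp add: \<epsilon>_def \<epsilon>'_def)
  ultimately have \<epsilon>4: "\<epsilon> ^ 4 = 1" using OK_unit_power4[OF D3] by blast
  show ?thesis
  \<comment> \<open>Scaling by \<epsilon> multiplies the norm by its cube, giving \<epsilon>^4 = 1,
    and preserves the relations with \<open>u1\<close>, \<open>u2\<close>,
    \<open>u3\<close>.\<close>
  proof (rule that[of "\<epsilon> * (b1 / c)" "\<epsilon> * (b2 / c)" "\<epsilon> * (b3 / c)"])
    have "\<epsilon> * (b1 / c) * (\<epsilon> * (b2 / c)) * (\<epsilon> * (b3 / c)) = \<epsilon> ^ 3 * ((b1 / c) * (b2 / c) * (b3 / c))"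
      by (simp add: power3_eq_cube)
    also have "\<dots> = \<epsilon> ^ 4" unfolding \<epsilon>N[symmetric] by (simp add: power3_eq_cube power4_eq_xxxx)
    finally have N1: "\<epsilon> * (b1 / c) * (\<epsilon> * (b2 / c)) * (\<epsilon> * (b3 / c)) = 1" by (simp add: \<epsilon>4)
    show "unit_triple (\<epsilon> * (b1 / c)) (\<epsilon> * (b2 / c)) (\<epsilon> * (b3 / c))"
      unfolding unit_triple_def
      using N1 \<epsilon> xi by (intro conjI triple_cmult[OF R] xt algebraic_int_times) (auto simp: OK_iff)
    show "\<epsilon> * (b1 / c) = u1 * (\<epsilon> * (b2 / c))" by (subst bu(1)) simp
    show "\<epsilon> * (b2 / c) = u2 * (\<epsilon> * (b3 / c))" by (subst bu(2)) simp
    show "\<epsilon> * (b3 / c) = u3 * (\<epsilon> * (b1 / c))" by (subst bu(3)) simp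
  qed
qed

text \<open>Two applications of \<open>hilbert94\<close> give \<open>u1 = y1 * y3 / y2^2\<close>.
  Since \<open>y1 * y2 * y3 = 1\<close>, this is the inverse cube of \<open>y2\<close>, that is, the
  cube of \<open>y3 * y1\<close>.\<close>

lemma unit_triple_cube_root:
  assumes h: "\<not> 3 dvd class_number K" and u: "unit_triple u1 u2 u3"
  obtains v1 v2 v3 where "unit_triple v1 v2 v3" "u1 = v1 ^ 3" "u2 = v2 ^ 3" "u3 = v3 ^ 3"
proof -
  obtain x1 x2 x3 where x: "unit_triple x1 x2 x3" "x1 = u1 * x2" "x2 = u2 * x3" "x3 = u3 * x1"
    using hilbert94[OF h u] .
  obtain y1 y2 y3 where y: "unit_triple y1 y2 y3" "y1 = x1 * y2" "y2 = x2 * y3" "y3 = x3 * y1"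
    using hilbert94[OF h x(1)] .
  have yt: "triple K y1 y2 y3" and yi: "algebraic_int y1" "algebraic_int y2" "algebraic_int y3"
    and yn: "y1 * y2 * y3 = 1" using y(1) by (auto simp: unit_triple_def)
  have y0: "y1 \<noteq> 0" "y2 \<noteq> 0" "y3 \<noteq> 0" using yn by auto
  have yt2: "triple K y2 y3 y1" using yt triple_rotate by blast
  have yt3: "triple K y3 y1 y2" using yt2 triple_rotate by blast
  have cube: "u = (z * a) ^ 3"
    if "x = u * x'" "a = x * b" "b = x' * z" "a * b * z = 1" for u x x' a b z :: complex
  proof -
    have "z * a = z * (u * x' * b)" using that(1,2) by simp
    also have "\<dots> = u * (b * (x' * z))" by (simp only: mult_ac)
    finally have *: "z * a = u * (b * b)" using that(3) by simp
    have "(z * a) ^ 3 = u * (b * b) * (z * a) * (z * a)" by (simp add: power3_eq_cube flip: *)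
    also have "\<dots> = u * (a * b * z) * (a * b * z)" by (simp only: mult_ac)
    finally show ?thesis by (simp add: that(4))
  qed
  have yn': "y2 * y3 * y1 = 1" "y3 * y1 * y2 = 1" using yn by (simp_all only: mult_ac)
  show ?thesis
  proof (rule that[of "y3 * y1" "y1 * y2" "y2 * y3"])
    have "y3 * y1 * (y1 * y2) * (y2 * y3) = (y1 * y2 * y3) * (y1 * y2 * y3)" by simp
    hence "y3 * y1 * (y1 * y2) * (y2 * y3) = 1" by (simp add: yn)
    thus "unit_triple (y3 * y1) (y1 * y2) (y2 * y3)"
      unfolding unit_triple_def
      by (intro conjI triple_mult[OF rat_subring_K] algebraic_int_times yt yt2 yt3 yi)
    show "u1 = (y3 * y1) ^ 3" by (rule cube[OF x(2) y(2,3) yn])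
    show "u2 = (y1 * y2) ^ 3" by (rule cube[OF x(3) y(3,4) yn'(1)])
    show "u3 = (y2 * y3) ^ 3" by (rule cube[OF x(4) y(4,2) yn'(2)])
  qed
qed

text \<open>The conjugates are roots of a cubic with constant term -1 and bounded coefficients in
  \<open>OK\<close>, of which there are finitely many.\<close>

lemma finite_bounded_unit_triples:
  "finite {(v1, v2, v3). unit_triple v1 v2 v3 \<and> cmod v1 \<le> B \<and> cmod v2 \<le> B \<and> cmod v3 \<le> B}"
    (is "finite ?S")
proof -
  note R = rat_subring_K
  define C where "C = {x \<in> OK. cmod x \<le> max (3 * B) (3 * (B * B))}"
  define P where "P = (\<lambda>(t::complex, q::complex). [: -1, q, - t, 1 :])"
  define X where "X = (\<Union>p \<in> C \<times> C. {x. poly (P p) x = 0})"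
  have "finite X" unfolding X_def C_def
    by (intro finite_UN_I finite_cartesian_product finite_OK_bounded poly_roots_finite) (auto simp: P_def)
  moreover have "?S \<subseteq> X \<times> X \<times> X"
  proof safe
    fix v1 v2 v3 assume v: "unit_triple v1 v2 v3" and B: "cmod v1 \<le> B" "cmod v2 \<le> B" "cmod v3 \<le> B"
    have vt: "triple K v1 v2 v3" and vi: "algebraic_int v1" "algebraic_int v2" "algebraic_int v3"
      and vn: "v1 * v2 * v3 = 1" using v by (auto simp: unit_triple_def)
    define t q where "t = v1 + v2 + v3" and "q = v1 * v2 + v2 * v3 + v3 * v1"
    have "t \<in> OK" "q \<in> OK"
      unfolding t_def q_def OK_iff
      by (intro conjI triple_sum[OF R vt] triple_elementary_symmetric(1)[OF R vt] algebraic_int_closed vi)+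
    moreover have "cmod t \<le> 3 * B"
      unfolding t_def using B norm_triangle_ineq[of "v1 + v2" v3] norm_triangle_ineq[of v1 v2] by linarith
    moreover have "cmod q \<le> 3 * (B * B)"
    proof -
      have B0: "0 \<le> B" using B(1) norm_ge_zero order_trans by blast
      have "cmod (v1 * v2) \<le> B * B" "cmod (v2 * v3) \<le> B * B" "cmod (v3 * v1) \<le> B * B"
        unfolding norm_mult using B B0 by (auto intro!: mult_mono)
      thus ?thesis unfolding q_def
        using norm_triangle_ineq[of "v1 * v2 + v2 * v3" "v3 * v1"] norm_triangle_ineq[of "v1 * v2" "v2 * v3"]
        by linarith
    qed
    ultimately have tq: "(t, q) \<in> C \<times> C" by (auto simp: C_def)
    have "poly (P (t, q)) x = (x - v1) * (x - v2) * (x - v3)" for x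
    proof -
      have "poly (P (t, q)) x = x * x * x - t * (x * x) + q * x - 1"
        by (simp add: P_def algebra_simps)
      also have "\<dots> = x * x * x - t * (x * x) + q * x - v1 * v2 * v3" by (simp only: vn)
      also have "\<dots> = (x - v1) * (x - v2) * (x - v3)" by (simp add: t_def q_def algebra_simps)
      finally show ?thesis .
    qed
    hence "poly (P (t, q)) v1 = 0" "poly (P (t, q)) v2 = 0" "poly (P (t, q)) v3 = 0" by simp_all
    thus "v1 \<in> X" "v2 \<in> X" "v3 \<in> X" unfolding X_def using tq by blast+
  qed
  ultimately show ?thesis using finite_subset by blast
qed

text \<open>Among the triples bounded by \<open>B\<close>, take one whose second conjugate is least
  in absolute value above 1; its cube root would be smaller still. The bound survives taking cube
  roots because \<open>B\<close> exceeds 1.\<close>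

lemma class_number_dvd_3_if_unit:
  assumes u: "unit_triple u1 u2 u3" and u2: "cmod u2 > 1"
  shows "3 dvd class_number K"
proof (rule ccontr)
  assume h: "\<not> 3 dvd class_number K"
  define B where "B = max (max (cmod u1) (cmod u2)) (cmod u3)"
  define S where "S = {(v1, v2, v3). unit_triple v1 v2 v3 \<and> cmod v1 \<le> B \<and> cmod v2 \<le> B \<and> cmod v3 \<le> B}
    \<inter> {(v1, v2, v3). cmod v2 > 1}"
  have B1: "B > 1" using u2 by (simp add: B_def)
  have "finite S" unfolding S_def by (intro finite_Int disjI1 finite_bounded_unit_triples)
  moreover have "(u1, u2, u3) \<in> S" using u u2 by (auto simp: S_def B_def)
  ultimately obtain z where z: "z \<in> S" "\<And>y. y \<in> S \<Longrightarrow> cmod (fst (snd z)) \<le> cmod (fst (snd y))"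
    using arg_min_if_finite(1)[of S "\<lambda>v. cmod (fst (snd v))"] arg_min_least[of S _ "\<lambda>v. cmod (fst (snd v))"]
    by (metis empty_iff)
  obtain v1 v2 v3 where v: "z = (v1, v2, v3)" by (cases z)
  have vS: "unit_triple v1 v2 v3" "cmod v1 \<le> B" "cmod v2 \<le> B" "cmod v3 \<le> B" "cmod v2 > 1"
    using z(1) by (auto simp: S_def v)
  obtain x1 x2 x3 where x: "unit_triple x1 x2 x3" "v1 = x1 ^ 3" "v2 = x2 ^ 3" "v3 = x3 ^ 3"
    using unit_triple_cube_root[OF h vS(1)] .
  have bound: "cmod x \<le> B" if "cmod (x ^ 3) \<le> B" for x
  proof (rule ccontr)
    assume "\<not> cmod x \<le> B"
    hence "cmod x > B" "cmod x > 1" using B1 by auto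
    moreover from this have "cmod x ^ 1 \<le> cmod x ^ 3" by (intro power_increasing) auto
    ultimately show False using that by (simp add: norm_power)
  qed
  have x2: "cmod x2 > 1"
  proof (rule ccontr)
    assume "\<not> cmod x2 > 1"
    hence "cmod x2 ^ 3 \<le> 1" by (intro power_le_one) auto
    thus False using vS(5) x by (simp add: norm_power)
  qed
  have "(x1, x2, x3) \<in> S" using x x2 vS bound by (auto simp: S_def)
  from z(2)[OF this] have "cmod x2 ^ 3 \<le> cmod x2 ^ 1" by (simp add: v x norm_power)
  moreover have "cmod x2 ^ 1 < cmod x2 ^ 3" using x2 by (intro power_strict_increasing) auto
  ultimately show False by linarith
qed

end

section \<open>Existence of a unit of infinite order\<close>

context unramified_cubic
begin

text \<open>A rational root \<open>n\<close> would be an integer, and \<open>n ^ 3 + n\<close> is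
  even: the oddness of \<open>e\<close> enters here.\<close>

lemma no_rational_root:
  assumes "r \<in> \<rat>" "(r::complex) ^ 3 = of_int (- 2 * s) * r\<^sup>2 + of_int (- 1) * r + of_int e"
  shows False
proof -
  have "algebraic_int r" using assms(2) by (rule algebraic_int_monic_cubic)
  then obtain n where n: "r = of_int n"
    using rational_algebraic_int_is_int assms(1) by (auto elim: Ints_cases)
  have "of_int (n ^ 3) = (of_int (- 2 * s * n\<^sup>2 - n + e) :: complex)"
    using assms(2) by (simp add: n)
  hence "n ^ 3 = - 2 * s * n\<^sup>2 - n + e" using of_int_eq_iff by blast
  hence "e = n ^ 3 + n + 2 * (s * n\<^sup>2)" by simp
  hence "even e" by simp
  thus False using odd_e by blast
qed

text \<open>Divide the cubic by X^2 - \<alpha> X - \<beta>. A nonzero linear coefficient of the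
  remainder makes \<open>p\<close> rational; otherwise the remainder vanishes and the linear
  cofactor has a rational root.\<close>

lemma no_quadratic_root:
  assumes p: "(p::complex) ^ 3 = of_int (- 2 * s) * p\<^sup>2 + of_int (- 1) * p + of_int e"
    and q: "of_int c0 + of_int c1 * p + of_int c2 * p\<^sup>2 = 0" "c2 \<noteq> 0"
  shows False
proof -
  define \<alpha> \<beta> where "\<alpha> = (- of_int c1 / of_int c2 :: complex)" and "\<beta> = (- of_int c0 / of_int c2 :: complex)"
  define S E where "S = (of_int s :: complex)" and "E = (of_int e :: complex)"
  have Q: "\<alpha> \<in> \<rat>" "\<beta> \<in> \<rat>" "S \<in> \<rat>" "E \<in> \<rat>" by (simp_all add: \<alpha>_def \<beta>_def S_def E_def)
  have "of_int c2 * p\<^sup>2 = (of_int c0 + of_int c1 * p + of_int c2 * p\<^sup>2) - of_int c1 * p - of_int c0"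
    by simp
  also have "\<dots> = - of_int c1 * p - of_int c0" unfolding q(1) by simp
  finally have "of_int c2 * p\<^sup>2 = - of_int c1 * p - of_int c0" .
  hence "p\<^sup>2 = (- of_int c1 * p - of_int c0) / of_int c2"
    using q(2) by (simp only: eq_divide_eq mult.commute[of "of_int c2"]) simp
  hence p2: "p\<^sup>2 = \<alpha> * p + \<beta>"
    by (simp add: \<alpha>_def \<beta>_def diff_divide_distrib)
  have "p ^ 3 = p * p\<^sup>2" by (simp add: power2_eq_square power3_eq_cube)
  also have "\<dots> = p * (\<alpha> * p + \<beta>)" by (simp only: p2)
  also have "\<dots> = \<alpha> * p\<^sup>2 + \<beta> * p" by (simp add: power2_eq_square algebra_simps)
  also have "\<dots> = (\<alpha> * \<alpha> + \<beta>) * p + \<alpha> * \<beta>" unfolding p2 by (simp add: algebra_simps)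
  finally have "(\<alpha> * \<alpha> + \<beta>) * p + \<alpha> * \<beta> = - 2 * S * (\<alpha> * p + \<beta>) - p + E"
    using p by (simp add: S_def E_def p2)
  hence lin: "(\<alpha> * \<alpha> + \<beta> + 2 * S * \<alpha> + 1) * p = E - \<beta> * (\<alpha> + 2 * S)"
    by (simp add: algebra_simps)
  show False
  proof (cases "\<alpha> * \<alpha> + \<beta> + 2 * S * \<alpha> + 1 = 0")
    case True
    hence E: "E = \<beta> * (\<alpha> + 2 * S)" using lin by simp
    have \<beta>: "\<beta> = - (\<alpha> * \<alpha> + 2 * S * \<alpha> + 1)" using True by (simp add: add_eq_0_iff2 algebra_simps)
    \<comment> \<open>The root of the cofactor X + \<alpha> + 2 S.\<close>
    define r where "r = - (\<alpha> + 2 * S)"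
    have "r ^ 3 = - 2 * S * r\<^sup>2 - r + E"
      unfolding E unfolding \<beta> r_def by (simp add: power2_eq_square power3_eq_cube algebra_simps)
    hence "r ^ 3 = of_int (- 2 * s) * r\<^sup>2 + of_int (- 1) * r + of_int e" by (simp add: S_def E_def)
    moreover have "r \<in> \<rat>" using Q by (simp add: r_def)
    ultimately show False using no_rational_root by blast
  next
    case False
    hence "p = (E - \<beta> * (\<alpha> + 2 * S)) / (\<alpha> * \<alpha> + \<beta> + 2 * S * \<alpha> + 1)"
      using lin by (simp add: eq_divide_eq mult.commute)
    also have "\<dots> \<in> \<rat>" using Q by simp
    finally show False using no_rational_root p by blast
  qed
qed

text \<open>Integer coordinates of an element of Z[p1] are kept explicit because the pigeonhole
  argument reduces them modulo the norm.\<close>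

definition lin :: "int \<times> int \<times> int \<Rightarrow> complex \<Rightarrow> complex" where
  "lin c p = (case c of (c0, c1, c2) \<Rightarrow> of_int c0 + of_int c1 * p + of_int c2 * p\<^sup>2)"

lemma triple_lin: "rat_subring F \<Longrightarrow> triple F (lin c p1) (lin c p2) (lin c p3)"
  unfolding triple_def lin_def by (auto split: prod.splits intro!: rat_subringD)

lemma lin_algebraic_int: "algebraic_int (lin c p1)" "algebraic_int (lin c p2)" "algebraic_int (lin c p3)"
  unfolding lin_def by (auto split: prod.splits intro!: algebraic_int_closed p_algebraic_int)

lemma lin_norm:
  obtains N :: int where "lin c p1 * lin c p2 * lin c p3 = of_int N"
proof -
  have "lin c p1 * lin c p2 * lin c p3 \<in> \<rat>"
    by (intro triple_elementary_symmetric(2) rat_subring_Rats triple_lin)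
  moreover have "algebraic_int (lin c p1 * lin c p2 * lin c p3)"
    by (intro algebraic_int_times lin_algebraic_int)
  ultimately show ?thesis using that rational_algebraic_int_is_int by (auto elim: Ints_cases)
qed

lemma lin_nonzero:
  assumes "snd (snd c) \<noteq> 0" shows "lin c p1 \<noteq> 0" "lin c p2 \<noteq> 0" "lin c p3 \<noteq> 0"
  using assms no_quadratic_root[OF p_cubic(1)] no_quadratic_root[OF p_cubic(2)] no_quadratic_root[OF p_cubic(3)]
  by (auto simp: lin_def split: prod.splits)

text \<open>If \<open>q p\<^sub>1 \<approx> P\<^sub>1\<close> and \<open>q p\<^sub>1\<^sup>2 \<approx> P\<^sub>2\<close>, then \<open>P\<^sub>2 - P\<^sub>1 (p\<^sub>2 + p\<^sub>3) + q p\<^sub>2 p\<^sub>3\<close>,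
  whose conjugates solve the Vandermonde system with right-hand side \<open>(q, P\<^sub>1, P\<^sub>2)\<close> up to factors
  depending only on the cubic, has two small conjugates and bounded norm.\<close>

lemma small_conjugates:
  assumes real: "p1 \<in> \<real>"
  obtains R B :: real where "\<And>n. \<exists>c. snd (snd c) \<noteq> 0 \<and> cmod (lin c p2) \<le> R / Suc n \<and>
    cmod (lin c p1 * lin c p2 * lin c p3) \<le> B"
proof -
  define R where "R = 1 + (cmod p1 + cmod p2 + cmod p3)"
  define M where "M = cmod ((p1 - p2) * (p1 - p3))"
  have R: "R \<ge> 0" and M: "M \<ge> 0" by (auto simp: R_def M_def)
  obtain \<rho> where \<rho>: "p1 = of_real \<rho>" using real by (auto elim: Reals_cases)
  have "\<exists>c. snd (snd c) \<noteq> 0 \<and> cmod (lin c p2) \<le> R / N \<and>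
    cmod (lin c p1 * lin c p2 * lin c p3) \<le> (R + M) * R * R" if "N = Suc n" for N n
  proof -
    have N: "N > 0" using that by simp
    define \<theta> :: "nat \<Rightarrow> real" where "\<theta> i = (if i = 0 then \<rho> else \<rho>\<^sup>2)" for i
    obtain q P where q: "0 < q" "q \<le> int (N ^ 2)"
      and P: "\<And>i. i < 2 \<Longrightarrow> \<bar>of_int q * \<theta> i - of_int (P i)\<bar> < 1 / N"
      using Dirichlet_approx_simult[OF N, of 2 \<theta>] by blast
    define P1 P2 where "P1 = P 0" and "P2 = P 1"
    define e1 e2 where "e1 = of_int P1 - of_int q * p1" and "e2 = of_int P2 - of_int q * p1\<^sup>2"
    have "e1 = - of_real (of_int q * \<theta> 0 - of_int P1)" "e2 = - of_real (of_int q * \<theta> 1 - of_int P2)"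
      by (simp_all add: e1_def e2_def \<theta>_def \<rho>)
    hence e: "cmod e1 \<le> 1 / N" "cmod e2 \<le> 1 / N"
      using P[of 0] P[of 1] by (simp_all only: norm_minus_cancel norm_of_real P1_def P2_def) auto
    have small: "cmod (e2 - e1 * (x + y)) \<le> R / N"
      if "cmod x + cmod y \<le> cmod p1 + cmod p2 + cmod p3" for x y
    proof -
      have "cmod (e2 - e1 * (x + y)) \<le> cmod e2 + cmod e1 * cmod (x + y)"
        by (metis norm_triangle_ineq4 norm_mult)
      also have "\<dots> \<le> 1 / N + 1 / N * (cmod p1 + cmod p2 + cmod p3)"
        using e that norm_triangle_ineq[of x y] by (intro add_mono mult_mono) auto
      also have "\<dots> = R / N" by (simp add: R_def add_divide_distrib)
      finally show ?thesis .
    qed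
    \<comment> \<open>From eliminating the other two roots: their sum is -2s - p and their product 1
      + 2s p + p^2.\<close>
    define c where "c = (P2 + 2 * s * P1 + q, P1 + 2 * s * q, q)"
    have lin_c: "lin c p = of_int P2 - of_int P1 * (x + y) + of_int q * (x * y)"
      if "p + x + y = - 2 * of_int s" "p * x + x * y + y * p = 1" for p x y
    proof -
      have xy: "x + y = - 2 * of_int s - p" using that(1) by (simp add: algebra_simps)
      have "x * y = 1 - p * (x + y)" using that(2) by (simp add: algebra_simps)
      hence xy': "x * y = 1 + 2 * of_int s * p + p\<^sup>2" unfolding xy by (simp add: power2_eq_square algebra_simps)
      show ?thesis unfolding xy xy' lin_def c_def by (simp add: algebra_simps)
    qed
    have "lin c p2 = of_int P2 - of_int P1 * (p3 + p1) + of_int q * (p3 * p1)"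
      by (rule lin_c) (use p_sum p_sum2 in \<open>simp_all add: ac_simps\<close>)
    \<comment> \<open>With \<open>P1\<close>, \<open>P2\<close> replaced by \<open>q * p1\<close>
      and \<open>q\<close> times the square of \<open>p1\<close>, the expression vanishes at
      \<open>p2\<close>, so only the approximation errors remain.\<close>
    hence X2: "lin c p2 = e2 - e1 * (p3 + p1)"
      by (simp add: e1_def e2_def power2_eq_square algebra_simps)
    have "lin c p3 = of_int P2 - of_int P1 * (p1 + p2) + of_int q * (p1 * p2)"
      by (rule lin_c) (use p_sum p_sum2 in \<open>simp_all add: ac_simps\<close>)
    hence X3: "lin c p3 = e2 - e1 * (p1 + p2)"
      by (simp add: e1_def e2_def power2_eq_square algebra_simps)
    have "lin c p1 = of_int P2 - of_int P1 * (p2 + p3) + of_int q * (p2 * p3)"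
      by (rule lin_c) (use p_sum p_sum2 in \<open>simp_all add: ac_simps\<close>)
    hence X1: "lin c p1 = e2 - e1 * (p2 + p3) + of_int q * ((p1 - p2) * (p1 - p3))"
      by (simp add: e1_def e2_def power2_eq_square algebra_simps)
    have b2: "cmod (lin c p2) \<le> R / N" unfolding X2 by (rule small) auto
    have b3: "cmod (lin c p3) \<le> R / N" unfolding X3 by (rule small) auto
    have "cmod (lin c p1) \<le> R / N + cmod (of_int q * ((p1 - p2) * (p1 - p3)))"
      unfolding X1 by (intro order_trans[OF norm_triangle_ineq] add_mono small) auto
    also have "\<dots> = R / N + of_int q * M" using q by (simp add: norm_mult M_def)
    also have "\<dots> \<le> R * (real N)\<^sup>2 + (real N)\<^sup>2 * M"
    proof (intro add_mono mult_right_mono M)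
      have N1: "1 \<le> real N" using N by simp
      have "R / N \<le> R" using N1 R mult_left_mono[OF N1 R] by (simp add: divide_le_eq)
      also have "\<dots> \<le> R * (real N)\<^sup>2" using mult_left_mono[OF one_le_power[OF N1, of 2] R] by simp
      finally show "R / N \<le> R * (real N)\<^sup>2" .
      show "of_int q \<le> (real N)\<^sup>2" using q(2) by (metis of_int_le_iff of_int_of_nat_eq of_nat_power)
    qed
    \<comment> \<open>The growth N^2 of the large conjugate is offset by the two conjugates of size
      1/N.\<close>
    finally have b1: "cmod (lin c p1) \<le> (R + M) * (real N)\<^sup>2" by (simp add: algebra_simps)
    have "cmod (lin c p1 * lin c p2 * lin c p3) \<le> (R + M) * (real N)\<^sup>2 * (R / N) * (R / N)"
      unfolding norm_mult
      by (intro mult_mono b1 b2 b3 mult_nonneg_nonneg add_nonneg_nonneg divide_nonneg_nonneg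
          R M norm_ge_zero zero_le_power2 of_nat_0_le_iff)
    also have "\<dots> = (R + M) * R * R" using N by (simp add: power2_eq_square)
    finally have "cmod (lin c p1 * lin c p2 * lin c p3) \<le> (R + M) * R * R" .
    moreover have "snd (snd c) \<noteq> 0" using q by (simp add: c_def)
    ultimately show ?thesis using b2 by blast
  qed
  from that[OF this[OF refl]] show ?thesis .
qed

text \<open>Pigeonhole: infinitely many elements have bounded norm, so two share their norm
  \<open>N\<close> and are congruent modulo \<open>N\<close>; their quotient is then a unit.\<close>

lemma exists_unit:
  assumes real: "p1 \<in> \<real>"
  obtains u1 u2 u3 where "unit_triple u1 u2 u3" "cmod u2 > 1"
proof -
  obtain R B :: real where "\<And>n. \<exists>c. snd (snd c) \<noteq> 0 \<and> cmod (lin c p2) \<le> R / Suc n \<and>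
    cmod (lin c p1 * lin c p2 * lin c p3) \<le> B" using small_conjugates[OF real] by blast
  then obtain c where c: "\<And>n. snd (snd (c n)) \<noteq> 0" "\<And>n. cmod (lin (c n) p2) \<le> R / Suc n"
    "\<And>n. cmod (lin (c n) p1 * lin (c n) p2 * lin (c n) p3) \<le> B" by metis
  have "\<forall>n. \<exists>N::int. lin (c n) p1 * lin (c n) p2 * lin (c n) p3 = of_int N"
    using lin_norm by metis
  then obtain \<nu> :: "nat \<Rightarrow> int" where \<nu>: "\<And>n. lin (c n) p1 * lin (c n) p2 * lin (c n) p3 = of_int (\<nu> n)"
    by metis
  have nz: "lin (c n) p1 \<noteq> 0" "lin (c n) p2 \<noteq> 0" "lin (c n) p3 \<noteq> 0" for n
    using lin_nonzero[OF c(1)] by auto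
  have \<nu>0: "\<nu> n \<noteq> 0" for n using \<nu>[of n] nz[of n] by auto
  have \<nu>B: "\<bar>\<nu> n\<bar> \<le> \<lfloor>B\<rfloor>" for n
    using c(3)[of n] unfolding \<nu> by (simp add: le_floor_iff)
  \<comment> \<open>The norm is recorded with its sign, so that the quotient has norm 1 rather than
    -1.\<close>
  define f where "f n = (\<nu> n, fst (c n) mod \<nu> n, fst (snd (c n)) mod \<nu> n, snd (snd (c n)) mod \<nu> n)" for n
  let ?I = "{- \<lfloor>B\<rfloor>..\<lfloor>B\<rfloor>}"
  have mod: "x mod \<nu> n \<in> ?I" for x n
  proof -
    have "\<bar>x mod \<nu> n\<bar> < \<bar>\<nu> n\<bar>" using abs_mod_less[OF \<nu>0] .
    thus ?thesis using \<nu>B[of n] by auto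
  qed
  have "\<nu> n \<in> ?I" for n using \<nu>B[of n] by auto
  hence "range f \<subseteq> ?I \<times> ?I \<times> ?I \<times> ?I" using mod by (auto simp: f_def simp del: atLeastAtMost_iff)
  hence "finite (range f)" by (rule finite_subset) auto
  from pigeonhole_infinite[OF infinite_UNIV_nat this]
  obtain l where l: "infinite {n. f n = f l}" by auto
  \<comment> \<open>\<open>k\<close> is taken so late that its value at \<open>p2\<close> is below
    that of \<open>l\<close>, which makes the quotient exceed 1 there.\<close>
  obtain k where k: "f k = f l" "k > nat \<lceil>R / cmod (lin (c l) p2)\<rceil>"
    using l unfolding infinite_nat_iff_unbounded by blast
  have pos: "cmod (lin (c l) p2) > 0" using nz by simp
  have "R / cmod (lin (c l) p2) < real (Suc k)" using k(2) by linarith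
  hence "R / Suc k < cmod (lin (c l) p2)" using pos by (simp add: field_simps)
  hence less: "cmod (lin (c k) p2) < cmod (lin (c l) p2)" using c(2)[of k] by linarith
  obtain c0 c1 c2 where cl: "c l = (c0, c1, c2)" by (cases "c l")
  obtain d0 d1 d2 where ck: "c k = (d0, d1, d2)" by (cases "c k")
  define N where "N = \<nu> k"
  have N: "\<nu> l = N" "c0 mod N = d0 mod N" "c1 mod N = d1 mod N" "c2 mod N = d2 mod N"
    using k(1) by (auto simp: f_def N_def cl ck)
  obtain h0 h1 h2 where h: "c0 = d0 + N * h0" "c1 = d1 + N * h1" "c2 = d2 + N * h2"
    using N(2-4) by (metis mod_eq_dvd_iff dvdE diff_add_cancel add.commute)
  define g where "g = (h0, h1, h2)"
  have lin_lk: "lin (c l) p = lin (c k) p + of_int N * lin g p" for p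
    by (simp add: cl ck g_def h lin_def algebra_simps)
  define x1 x2 x3 where "x1 = lin (c k) p1" and "x2 = lin (c k) p2" and "x3 = lin (c k) p3"
  have x: "x1 * x2 * x3 = of_int N" using \<nu>[of k] by (simp add: x1_def x2_def x3_def N_def)
  have x0: "x1 \<noteq> 0" "x2 \<noteq> 0" "x3 \<noteq> 0" using nz by (auto simp: x1_def x2_def x3_def)
  have xi: "algebraic_int x1" "algebraic_int x2" "algebraic_int x3"
    by (auto simp: x1_def x2_def x3_def lin_algebraic_int)
  have xt: "triple K x1 x2 x3" unfolding x1_def x2_def x3_def by (intro triple_lin rat_subring_K)
  note xt2 = triple_rotate[OF xt] and xt3 = triple_rotate[OF triple_rotate[OF xt]]
  \<comment> \<open>\<open>u1\<close> is the quotient of the values at \<open>p1\<close>, that is 1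
    + N \<open>lin g p1\<close> / \<open>x1\<close>; writing \<open>x2 * x3\<close> for N /
    \<open>x1\<close> exhibits its integrality.\<close>
  define u1 u2 u3 where "u1 = 1 + lin g p1 * (x2 * x3)" and "u2 = 1 + lin g p2 * (x3 * x1)"
    and "u3 = 1 + lin g p3 * (x1 * x2)"
  have "lin (c l) p1 = x1 + x1 * x2 * x3 * lin g p1" "lin (c l) p2 = x2 + x1 * x2 * x3 * lin g p2"
    "lin (c l) p3 = x3 + x1 * x2 * x3 * lin g p3"
    unfolding x by (simp_all add: lin_lk x1_def x2_def x3_def)
  hence ux: "lin (c l) p1 = u1 * x1" "lin (c l) p2 = u2 * x2" "lin (c l) p3 = u3 * x3"
    by (simp_all add: u1_def u2_def u3_def algebra_simps)
  have "(u1 * u2 * u3) * (x1 * x2 * x3) = lin (c l) p1 * lin (c l) p2 * lin (c l) p3"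
    unfolding ux by (simp only: mult_ac)
  also have "\<dots> = x1 * x2 * x3" using \<nu>[of l] N(1) x by simp
  finally have "u1 * u2 * u3 = 1" using x0 by simp
  hence "unit_triple u1 u2 u3"
    unfolding unit_triple_def u1_def u2_def u3_def
    by (intro conjI triple_add[OF rat_subring_K] triple_mult[OF rat_subring_K] triple_const[OF rat_subring_K]
        triple_lin[OF rat_subring_K] K_1 xt xt2 xt3 algebraic_int_closed lin_algebraic_int xi)
  moreover have "cmod u2 > 1"
  proof -
    have "1 * cmod x2 < cmod u2 * cmod x2" using less ux(2) by (simp add: x2_def norm_mult)
    thus ?thesis using x0 by simp
  qed
  ultimately show ?thesis using that by blast
qed

end

section \<open>The theorem\<close>

text \<open>The intermediate value theorem supplies a real root, as needed for Dirichlet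
  approximation, and the quadratic formula the other two.\<close>

lemma cubic_roots:
  fixes b c d :: real
  obtains p1 p2 p3 :: complex where "p1 \<in> \<real>" "p1 + p2 + p3 = - of_real b"
    "p1 * p2 + p2 * p3 + p3 * p1 = of_real c" "p1 * p2 * p3 = of_real d"
proof -
  define h where "h x = x ^ 3 + b * x\<^sup>2 + c * x - d" for x :: real
  \<comment> \<open>Cauchy's root bound: at distance \<open>M\<close> from 0 the cubic term
    dominates.\<close>
  define M where "M = 1 + \<bar>b\<bar> + \<bar>c\<bar> + \<bar>d\<bar>"
  have M: "M \<ge> 1" by (simp add: M_def)
  have bound: "\<bar>b * x\<^sup>2 + c * x - d\<bar> \<le> (M - 1) * M\<^sup>2" if x: "\<bar>x\<bar> = M" for x
  proof -
    have x2: "x\<^sup>2 = M\<^sup>2" using x by (metis power2_abs)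
    have M2: "1 \<le> M\<^sup>2" using M by (rule one_le_power)
    have M3: "M \<le> M\<^sup>2" using M mult_left_mono[of 1 M M] by (simp add: power2_eq_square)
    have "\<bar>b * x\<^sup>2 + c * x - d\<bar> \<le> \<bar>b * x\<^sup>2\<bar> + \<bar>c * x\<bar> + \<bar>d\<bar>" by linarith
    also have "\<dots> = \<bar>b\<bar> * M\<^sup>2 + \<bar>c\<bar> * M + \<bar>d\<bar> * 1" by (simp add: abs_mult x x2)
    also have "\<dots> \<le> \<bar>b\<bar> * M\<^sup>2 + \<bar>c\<bar> * M\<^sup>2 + \<bar>d\<bar> * M\<^sup>2"
      using M2 M3 by (intro add_mono mult_left_mono) auto
    finally show ?thesis by (simp add: M_def algebra_simps)
  qed
  have M3: "(M - 1) * M\<^sup>2 \<le> M ^ 3"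
    using M by (simp add: power2_eq_square power3_eq_cube algebra_simps)
  have "h (- M) \<le> 0" using bound[of "- M"] M M3 by (simp add: h_def)
  moreover have "0 \<le> h M" using bound[of M] M M3 by (simp add: h_def)
  moreover have "continuous_on {- M..M} h" unfolding h_def by (intro continuous_intros)
  ultimately obtain \<rho> where \<rho>: "h \<rho> = 0" using IVT'[of h "- M" 0 M] M by auto
  define p1 where "p1 = complex_of_real \<rho>"
  define B C where "B = of_real b + p1" and "C = of_real c + p1 * B"
  define \<Delta> where "\<Delta> = csqrt (B\<^sup>2 - 4 * C)"
  have \<Delta>: "\<Delta> * \<Delta> = B * B - 4 * C" unfolding \<Delta>_def by (metis power2_csqrt power2_eq_square)
  define p2 p3 where "p2 = (- B + \<Delta>) / 2" and "p3 = (- B - \<Delta>) / 2"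
  have sum: "p2 + p3 = - B" by (simp add: p2_def p3_def flip: add_divide_distrib)
  have "p2 * p3 = (B * B - \<Delta> * \<Delta>) / 4" by (simp add: p2_def p3_def algebra_simps)
  hence prod: "p2 * p3 = C" unfolding \<Delta> by simp
  show ?thesis
  proof (rule that[of p1 p2 p3])
    show "p1 \<in> \<real>" by (simp add: p1_def)
    have "p1 + p2 + p3 = p1 + (p2 + p3)" by simp
    thus "p1 + p2 + p3 = - of_real b" unfolding sum by (simp add: B_def)
    have "p1 * p2 + p2 * p3 + p3 * p1 = p1 * (p2 + p3) + p2 * p3" by (simp add: algebra_simps)
    thus "p1 * p2 + p2 * p3 + p3 * p1 = of_real c" unfolding sum prod by (simp add: C_def)
    have "of_real (h \<rho>) = (0::complex)" by (simp add: \<rho>)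
    hence "p1 ^ 3 + of_real b * p1\<^sup>2 + of_real c * p1 = of_real d" by (simp add: h_def p1_def)
    moreover have "p1 * C = p1 ^ 3 + of_real b * p1\<^sup>2 + of_real c * p1"
      by (simp add: C_def B_def power2_eq_square power3_eq_cube algebra_simps)
    ultimately show "p1 * p2 * p3 = of_real d" by (simp add: mult.assoc prod)
  qed
qed

theorem theorem2p2:
  fixes m n s :: int
  assumes "odd m" and "odd n"
    and "[m = 0] (mod 3)"
    and "multiplicity 3 n = 1"
    and "s = 1 \<or> s = -1"
  defines "K \<equiv> quadratic_field (- of_int (m^2 * n^2 + s * (4 * n)) / 3)"
  shows "finite (carrier (class_group K)) \<and> 3 dvd class_number K"
proof -
  have s2: "s * s = 1" using assms(5) by auto
  obtain a where m: "m = 3 * a" using assms(3) by (auto simp: cong_0_iff)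
  have n0: "n \<noteq> 0" using assms(2) by auto
  have "3 dvd n" using multiplicity_dvd[of 3 n] assms(4) by simp
  then obtain k where n: "n = 3 * k" by auto
  have k3: "\<not> 3 dvd k"
  proof
    assume "3 dvd k"
    hence "3 ^ 2 dvd n" by (auto simp: n)
    hence "2 \<le> multiplicity 3 n" using n0 by (intro multiplicity_geI) auto
    thus False using assms(4) by simp
  qed
  have odd: "odd a" "odd k" using assms(1,2) m n by auto
  define e where "e = a\<^sup>2 * k"
  define D where "D = - k * (27 * e + 4 * s)"
  have a0: "a \<noteq> 0" "k \<noteq> 0" using odd by auto
  have "a\<^sup>2 \<ge> 1" using a0 by (simp add: int_one_le_iff_zero_less)
  \<comment> \<open>As 27 exceeds 4, \<open>27 * e + 4 * s\<close> has the sign of \<open>e\<close>,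
    which is that of \<open>k\<close>.\<close>
  have "D < 0"
  proof (cases "k > 0")
    case True
    hence "e \<ge> 1" using \<open>a\<^sup>2 \<ge> 1\<close> unfolding e_def by (smt (verit) mult_le_cancel_right1 mult_less_cancel_right1)
    hence "27 * e + 4 * s > 0" using assms(5) by auto
    thus ?thesis using True by (simp add: D_def mult_pos_pos)
  next
    case False
    hence "k < 0" using a0 by simp
    moreover from this have "e \<le> -1" using \<open>a\<^sup>2 \<ge> 1\<close> a0 unfolding e_def
      by (metis int_one_le_iff_zero_less less_le_not_le linorder_not_less mult_pos_neg zero_less_power2 zle_diff1_eq zle_add1_eq_le add.commute diff_0 uminus_add_conv_diff)
    hence "27 * e + 4 * s < 0" using assms(5) by auto
    ultimately show ?thesis by (simp add: D_def mult_neg_neg)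
  qed
  \<comment> \<open>Modulo 3, \<open>D\<close> is \<open>- 4 * s * k\<close>; here the exact
    valuation of \<open>n\<close> enters through \<open>k3\<close>.\<close>
  have D3: "\<not> 3 dvd D"
  proof
    assume "3 dvd D"
    moreover have "4 * (s * k) = - D - 3 * (9 * (k * e))" by (simp add: D_def algebra_simps)
    ultimately have "3 dvd 4 * (s * k)" by simp
    hence "3 dvd 4 * k" using assms(5) by auto
    hence "3 dvd k" by presburger
    thus False using k3 by simp
  qed
  obtain p1 p2 p3 :: complex where real: "p1 \<in> \<real>" and p: "p1 + p2 + p3 = - of_real (2 * of_int s)"
    "p1 * p2 + p2 * p3 + p3 * p1 = of_real 1" "p1 * p2 * p3 = of_real (of_int e)"
    using cubic_roots by blast
  interpret C: unramified_cubic D s e a p1 p2 p3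
  proof
    show "a\<^sup>2 * D = - e * (27 * e + 4 * s)" by (simp add: D_def e_def)
    show "odd e" using odd by (simp add: e_def)
  qed (use \<open>D < 0\<close> s2 a0 D3 p in simp_all)
  have "m\<^sup>2 * n\<^sup>2 + s * (4 * n) = - 3 * D"
    by (simp add: m n D_def e_def power2_eq_square algebra_simps)
  hence rat: "- of_int (m\<^sup>2 * n\<^sup>2 + s * (4 * n)) / 3 = (of_int D :: rat)" by simp
  have K: "K = imaginary_quadratic.K D"
    unfolding K_def imaginary_quadratic.K_def[OF C.imaginary_quadratic_axioms] rat ..
  obtain u1 u2 u3 where "C.unit_triple u1 u2 u3" "cmod u2 > 1" using C.exists_unit[OF real] .
  thus ?thesis unfolding K using C.finite_class_group C.class_number_dvd_3_if_unit by blast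
qed

end
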